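(* Let $D$ be the space-time dimension and let $T_{[ab]c}$ be a tensor field satisfying $T_{[ab]c}=-T_{[ba]c}$ and $T_{[ab]c}+T_{[ca]b}+T_{[bc]a}=0$. Let $f$ be a polynomial in the components $T_{[ab]c}$ and finitely many of their partial derivatives. Then $f$ is strictly gauge invariant, i.e. $\delta_{\epsilon,\eta}f=0$ for all gauge parameters $\epsilon_{ab}=\epsilon_{ba}$, $\eta_{ab}=-\eta_{ba}$ under $$\delta_{\epsilon,\eta}T_{[ab]c}=\partial_a\epsilon_{bc}-\partial_b\epsilon_{ac}+\partial_a\eta_{bc}-\partial_b\eta_{ac}-2\partial_c\eta_{ab},$$ if and only if $f$ is a polynomial in the variables $E^T_{abcd_1\ldots d_k}$, $k\ge 2$, defined in the context. In particular, every non-constant strictly gauge invariant polynomial involves derivatives of $T_{[ab]c}$ of order at least two.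
   Context: Indices $a,b,c,d_i,\ldots$ run over $D$ values; $\partial_a$ are commuting partial derivatives, and $\partial_{d_1\ldots d_k}=\partial_{d_1}\cdots\partial_{d_k}$. The polynomial $f$ has constant real coefficients, and the derivatives $\partial_{d_1\ldots d_k}T_{[ab]c}$, $k\ge0$, are regarded as independent variables (jet coordinates), subject only to symmetry in $d_1,\ldots,d_k$ and the stated index symmetries of $T_{[ab]c}$. The gauge parameters $\epsilon_{ab}$ (symmetric) and $\eta_{ab}$ (antisymmetric) are arbitrary smooth functions. The gauge variation $\delta_{\epsilon,\eta}$ acts on polynomials in $T$ and its derivatives as a derivation commuting with $\partial_a$. "Strictly" gauge invariant means that the variation vanishes identically, not merely up to a total derivative or on-shell. For $k\ge 2$, $E^T_{abcd_1\ldots d_k}$ is the component of $\partial_{d_1\ldots d_k}T_{[ab]c}$ associated with the Young tableau of shape $(k,2,1)$ whose first row is $a,c,d_1,\ldots,d_{k-2}$, second row is $b,d_{k-1}$, and third row is $d_k$. It is obtained by first symmetrizing $\partial_{d_1\ldots d_k}T_{[ab]c}$ over the indices in each row, and then antisymmetrizing the result over the indices in each column (columns $\{a,b,d_k\}$ and $\{c,d_{k-1}\}$, the other columns having one box), each (anti)symmetrization over $n$ indices being normalized by $1/n!$. *)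

theory Defs
  imports
    "HOL-Analysis.Analysis"
    "HOL-Library.Poly_Mapping"
    "HOL-Combinatorics.Permutations"
begin

section \<open>Multivariate polynomials over the reals\<close>

type_synonym 'v rpoly = "('v \<Rightarrow>\<^sub>0 nat) \<Rightarrow>\<^sub>0 real"

definition pconst :: "real \<Rightarrow> 'v rpoly"
  where "pconst r = Poly_Mapping.single 0 r"

definition pvar :: "'v \<Rightarrow> 'v rpoly"
  where "pvar v = Poly_Mapping.single (Poly_Mapping.single v 1) 1"

definition pvars :: "'v rpoly \<Rightarrow> 'v set"
  where "pvars p = (\<Union>m\<in>Poly_Mapping.keys p. Poly_Mapping.keys m)"

definition psubst :: "('v \<Rightarrow> 'w rpoly) \<Rightarrow> 'v rpoly \<Rightarrow> 'w rpoly"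
  where "psubst \<phi> p =
    (\<Sum>m\<in>Poly_Mapping.keys p.
       pconst (Poly_Mapping.lookup p m) *
       (\<Prod>v\<in>Poly_Mapping.keys m. \<phi> v ^ Poly_Mapping.lookup m v))"

text \<open>The derivation \<open>\<Sum>v. \<phi> v * (\<partial>/\<partial>v)\<close>, i.e. the \<open>\<real>\<close>-linear derivation
  with prescribed values \<open>\<phi> v\<close> on the variables (see the lemmas below).\<close>

definition derivation :: "('v \<Rightarrow> 'v rpoly) \<Rightarrow> 'v rpoly \<Rightarrow> 'v rpoly"
  where "derivation \<phi> p =
    (\<Sum>m\<in>Poly_Mapping.keys p. \<Sum>v\<in>Poly_Mapping.keys m.
       Poly_Mapping.single (m - Poly_Mapping.single v 1)
         (Poly_Mapping.lookup p m * real (Poly_Mapping.lookup m v)) * \<phi> v)"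

lemma derivation_superset:
  assumes "finite A" "Poly_Mapping.keys p \<subseteq> A"
  shows "derivation \<phi> p =
    (\<Sum>m\<in>A. \<Sum>v\<in>Poly_Mapping.keys m.
       Poly_Mapping.single (m - Poly_Mapping.single v 1)
         (Poly_Mapping.lookup p m * real (Poly_Mapping.lookup m v)) * \<phi> v)"
  unfolding derivation_def
  by (rule sum.mono_neutral_left) (use assms in \<open>auto simp: in_keys_iff\<close>)

lemma derivation_add: "derivation \<phi> (p + q) = derivation \<phi> p + derivation \<phi> q"
proof -
  let ?A = "Poly_Mapping.keys p \<union> Poly_Mapping.keys q"
  have "Poly_Mapping.keys (p + q) \<subseteq> ?A"
    by (rule Poly_Mapping.keys_add)
  then show ?thesis
    by (subst (1 2 3) derivation_superset[of ?A])
      (auto simp: lookup_add ring_distribs single_add sum.distrib)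
qed

lemma derivation_zero [simp]: "derivation \<phi> 0 = 0"
  by (simp add: derivation_def)

lemma derivation_sum: "derivation \<phi> (sum g A) = (\<Sum>x\<in>A. derivation \<phi> (g x))"
  by (induction A rule: infinite_finite_induct) (auto simp: derivation_add)

lemma derivation_single:
  "derivation \<phi> (Poly_Mapping.single m r) =
    (\<Sum>v\<in>Poly_Mapping.keys m.
       Poly_Mapping.single (m - Poly_Mapping.single v 1) (r * real (Poly_Mapping.lookup m v)) * \<phi> v)"
  by (subst derivation_superset[of "{m}"]) auto

lemma derivation_pconst [simp]: "derivation \<phi> (pconst r) = 0"
  by (simp add: pconst_def derivation_single)

lemma derivation_pvar [simp]: "derivation \<phi> (pvar v) = \<phi> v"
  by (simp add: pvar_def derivation_single)

lemma derivation_mult_single: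
  "derivation \<phi> (Poly_Mapping.single m r * Poly_Mapping.single n s) =
     Poly_Mapping.single m r * derivation \<phi> (Poly_Mapping.single n s)
     + derivation \<phi> (Poly_Mapping.single m r) * Poly_Mapping.single n s"
proof -
  let ?K = "Poly_Mapping.keys m \<union> Poly_Mapping.keys n"
  have keys: "Poly_Mapping.keys (m + n) = ?K"
    by (auto simp: in_keys_iff lookup_add)
  have ext: "derivation \<phi> (Poly_Mapping.single k t) =
    (\<Sum>v\<in>?K. Poly_Mapping.single (k - Poly_Mapping.single v 1)
        (t * real (Poly_Mapping.lookup k v)) * \<phi> v)"
    if "Poly_Mapping.keys k \<subseteq> ?K" for k and t :: real
    unfolding derivation_single
    by (rule sum.mono_neutral_left) (use that in \<open>auto simp: in_keys_iff\<close>)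
  have shift: "Poly_Mapping.single (k + l - Poly_Mapping.single v 1)
        (t * real (Poly_Mapping.lookup k v)) =
      Poly_Mapping.single (k - Poly_Mapping.single v 1 + l) (t * real (Poly_Mapping.lookup k v))"
    for k l :: "'a \<Rightarrow>\<^sub>0 nat" and v and t :: real
  proof (cases "Poly_Mapping.lookup k v = 0")
    case False
    then have "k + l - Poly_Mapping.single v 1 = k - Poly_Mapping.single v 1 + l"
      by (intro poly_mapping_eqI) (auto simp: lookup_add lookup_minus lookup_single when_def)
    then show ?thesis by simp
  qed simp
  have eq: "Poly_Mapping.single (m + n - Poly_Mapping.single v 1)
        (r * s * real (Poly_Mapping.lookup (m + n) v)) =
      Poly_Mapping.single m r *
        Poly_Mapping.single (n - Poly_Mapping.single v 1) (s * real (Poly_Mapping.lookup n v))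
      + Poly_Mapping.single (m - Poly_Mapping.single v 1) (r * real (Poly_Mapping.lookup m v))
        * Poly_Mapping.single n s" for v
    using shift[of m n v "r * s"] shift[of n m v "r * s"]
    by (simp add: mult_single lookup_add ring_distribs single_add ac_simps)
  have "derivation \<phi> (Poly_Mapping.single m r * Poly_Mapping.single n s) =
      (\<Sum>v\<in>?K. Poly_Mapping.single (m + n - Poly_Mapping.single v 1)
         (r * s * real (Poly_Mapping.lookup (m + n) v)) * \<phi> v)"
    by (simp add: mult_single derivation_single keys)
  also have "\<dots> = Poly_Mapping.single m r * derivation \<phi> (Poly_Mapping.single n s)
     + derivation \<phi> (Poly_Mapping.single m r) * Poly_Mapping.single n s"
    unfolding eq by (simp add: ext sum.distrib sum_distrib_left sum_distrib_right ring_distribs ac_simps)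
  finally show ?thesis .
qed

lemma rpoly_decompose:
  "p = (\<Sum>m\<in>Poly_Mapping.keys p. Poly_Mapping.single m (Poly_Mapping.lookup p m))"
  by (rule poly_mapping_eqI) (auto simp: lookup_sum lookup_single when_def in_keys_iff)

lemma derivation_mult: "derivation \<phi> (p * q) = p * derivation \<phi> q + derivation \<phi> p * q"
proof -
  have "derivation \<phi> ((\<Sum>m\<in>A. Poly_Mapping.single m (f m)) * (\<Sum>n\<in>B. Poly_Mapping.single n (g n))) =
      (\<Sum>m\<in>A. Poly_Mapping.single m (f m)) * derivation \<phi> (\<Sum>n\<in>B. Poly_Mapping.single n (g n))
      + derivation \<phi> (\<Sum>m\<in>A. Poly_Mapping.single m (f m)) * (\<Sum>n\<in>B. Poly_Mapping.single n (g n))"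
    for A B and f g :: "('a \<Rightarrow>\<^sub>0 nat) \<Rightarrow> real"
    by (simp add: sum_product derivation_sum derivation_mult_single sum.distrib)
  from this[where A = "Poly_Mapping.keys p" and f = "Poly_Mapping.lookup p"
      and B = "Poly_Mapping.keys q" and g = "Poly_Mapping.lookup q"]
  show ?thesis
    by (simp only: rpoly_decompose[symmetric])
qed


section \<open>Jet coordinates of the mixed-symmetry field\<close>

text \<open>\<open>Jet a b c [d\<^sub>1, \<dots>, d\<^sub>k]\<close> is the symbol
  \<open>\<partial>\<^bsub>d1\<dots>dk\<^esub> T\<^bsub>[ab]c\<^esub>\<close>; the \<open>D\<close> index values are the elements of \<open>'n\<close>.
  All index symmetries are imposed by working modulo the ideal \<open>jet_ideal\<close>, so that
  a polynomial in the field and its derivatives is a class of the congruence \<open>jet_eq\<close>.\<close>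

datatype 'n jet = Jet (jidx1: 'n) (jidx2: 'n) (jidx3: 'n) (jderivs: "'n list")

definition jet_order :: "'n jet \<Rightarrow> nat"
  where "jet_order v = length (jderivs v)"

definition jet_relations :: "'n jet rpoly set"
  where "jet_relations =
      {pvar (Jet a b c ds) - pvar (Jet a b c ds') | a b c ds ds'. mset ds = mset ds'}
    \<union> {pvar (Jet a b c ds) + pvar (Jet b a c ds) | a b c ds. True}
    \<union> {pvar (Jet a b c ds) + pvar (Jet c a b ds) + pvar (Jet b c a ds) | a b c ds. True}"

definition jet_ideal :: "'n jet rpoly set"
  where "jet_ideal = module.span (*) jet_relations"

definition jet_eq :: "'n jet rpoly \<Rightarrow> 'n jet rpoly \<Rightarrow> bool"  (infix \<open>\<approx>\<^sub>J\<close> 50)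
  where "f \<approx>\<^sub>J g \<longleftrightarrow> f - g \<in> jet_ideal"


section \<open>Gauge variation\<close>

definition partial :: "'n::finite \<Rightarrow> (real^'n \<Rightarrow> real) \<Rightarrow> real^'n \<Rightarrow> real"
  where "partial a g x = frechet_derivative g (at x) (axis a 1)"

definition partials :: "'n::finite list \<Rightarrow> (real^'n \<Rightarrow> real) \<Rightarrow> real^'n \<Rightarrow> real"
  where "partials ds g = foldr partial ds g"

definition smooth_fun :: "(real^'n::finite \<Rightarrow> real) \<Rightarrow> bool"
  where "smooth_fun g \<longleftrightarrow> (\<forall>ds x. partials ds g differentiable (at x))"

definition sym_param :: "('n::finite \<Rightarrow> 'n \<Rightarrow> real^'n \<Rightarrow> real) \<Rightarrow> bool"
  where "sym_param \<epsilon> \<longleftrightarrow> (\<forall>a b. smooth_fun (\<epsilon> a b) \<and> \<epsilon> a b = \<epsilon> b a)"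

definition antisym_param :: "('n::finite \<Rightarrow> 'n \<Rightarrow> real^'n \<Rightarrow> real) \<Rightarrow> bool"
  where "antisym_param \<eta> \<longleftrightarrow> (\<forall>a b. smooth_fun (\<eta> a b) \<and> \<eta> a b = - \<eta> b a)"

definition gauge_T ::
  "('n::finite \<Rightarrow> 'n \<Rightarrow> real^'n \<Rightarrow> real) \<Rightarrow> ('n \<Rightarrow> 'n \<Rightarrow> real^'n \<Rightarrow> real) \<Rightarrow>
    'n \<Rightarrow> 'n \<Rightarrow> 'n \<Rightarrow> real^'n \<Rightarrow> real"
  where "gauge_T \<epsilon> \<eta> a b c x =
      partial a (\<epsilon> b c) x - partial b (\<epsilon> a c) x
    + partial a (\<eta> b c) x - partial b (\<eta> a c) x - 2 * partial c (\<eta> a b) x"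

text \<open>The gauge variation of a polynomial has coefficients that are smooth functions on
  space-time; \<open>gauge_variation \<epsilon> \<eta> x f\<close> is its value with coefficients taken at the point \<open>x\<close>.
  Commutation with the derivatives fixes its value on the jet coordinates:
  \<open>\<delta>(\<partial>\<^bsub>d1\<dots>dk\<^esub> T\<^bsub>[ab]c\<^esub>) = \<partial>\<^bsub>d1\<dots>dk\<^esub> (\<delta> T\<^bsub>[ab]c\<^esub>)\<close>.\<close>

definition gauge_variation ::
  "('n::finite \<Rightarrow> 'n \<Rightarrow> real^'n \<Rightarrow> real) \<Rightarrow> ('n \<Rightarrow> 'n \<Rightarrow> real^'n \<Rightarrow> real) \<Rightarrow>
    real^'n \<Rightarrow> 'n jet rpoly \<Rightarrow> 'n jet rpoly"
  where "gauge_variation \<epsilon> \<eta> x =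
    derivation (\<lambda>v. pconst (partials (jderivs v) (gauge_T \<epsilon> \<eta> (jidx1 v) (jidx2 v) (jidx3 v)) x))"

definition strictly_gauge_invariant :: "'n::finite jet rpoly \<Rightarrow> bool"
  where "strictly_gauge_invariant f \<longleftrightarrow>
    (\<forall>\<epsilon> \<eta>. sym_param \<epsilon> \<longrightarrow> antisym_param \<eta> \<longrightarrow> (\<forall>x. gauge_variation \<epsilon> \<eta> x f \<approx>\<^sub>J 0))"


section \<open>The tensors \<open>E\<close>\<close>

text \<open>A tensor is a function of the assignment of index values to its numbered slots; slots
  \<open>0, 1, 2\<close> carry \<open>a, b, c\<close> and slot \<open>i + 2\<close> carries \<open>d\<^sub>i\<close>.\<close>

type_synonym 'n slot_tensor = "(nat \<Rightarrow> 'n) \<Rightarrow> 'n jet rpoly"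

definition symmetrize :: "nat set \<Rightarrow> 'n slot_tensor \<Rightarrow> 'n slot_tensor"
  where "symmetrize S t i = pconst (1 / fact (card S)) * (\<Sum>p | p permutes S. t (i \<circ> p))"

definition antisymmetrize :: "nat set \<Rightarrow> 'n slot_tensor \<Rightarrow> 'n slot_tensor"
  where "antisymmetrize S t i =
    pconst (1 / fact (card S)) * (\<Sum>p | p permutes S. pconst (of_int (sign p)) * t (i \<circ> p))"

definition jet_tensor :: "nat \<Rightarrow> 'n slot_tensor"
  where "jet_tensor k i = pvar (Jet (i 0) (i 1) (i 2) (map i [3..<k+3]))"

text \<open>Only meaningful for \<open>k \<ge> 2\<close>.  Rows of the tableau of shape \<open>(k,2,1)\<close>:
  \<open>a, c, d\<^sub>1, \<dots>, d\<^bsub>k-2\<^esub>\<close> (slots \<open>0, 2, 3, \<dots>, k\<close>); \<open>b, d\<^bsub>k-1\<^esub>\<close> (slots \<open>1, k+1\<close>);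
  \<open>d\<^sub>k\<close> (slot \<open>k+2\<close>).\<close>

definition E_slots :: "nat \<Rightarrow> 'n slot_tensor"
  where "E_slots k =
    antisymmetrize {0, 1, k+2} (antisymmetrize {2, k+1}
      (symmetrize ({0, 2} \<union> {3..k}) (symmetrize {1, k+1} (jet_tensor k))))"

definition E_T :: "'n \<Rightarrow> 'n \<Rightarrow> 'n \<Rightarrow> 'n list \<Rightarrow> 'n jet rpoly"
  where "E_T a b c ds = E_slots (length ds) (\<lambda>j. (a # b # c # ds) ! j)"

text \<open>Being a polynomial in the variables \<open>E\<^bsub>abcd1\<dots>dk\<^esub>\<close>, \<open>k \<ge> 2\<close>: the polynomial \<open>g\<close>
  uses the symbol \<open>Jet a b c [d\<^sub>1, \<dots>, d\<^sub>k]\<close> as a placeholder for \<open>E\<^bsub>abcd1\<dots>dk\<^esub>\<close>.\<close>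

definition polynomial_in_E :: "'n jet rpoly \<Rightarrow> bool"
  where "polynomial_in_E f \<longleftrightarrow>
    (\<exists>g :: 'n jet rpoly. (\<forall>v\<in>pvars g. 2 \<le> jet_order v) \<and>
       f \<approx>\<^sub>J psubst (\<lambda>v. E_T (jidx1 v) (jidx2 v) (jidx3 v) (jderivs v)) g)"

definition constant_poly :: "'n jet rpoly \<Rightarrow> bool"
  where "constant_poly f \<longleftrightarrow> (\<exists>r. f \<approx>\<^sub>J pconst r)"

text \<open>Involvement of derivatives of order at least \<open>n\<close> does not depend on the representative:
  no representative gets by with derivatives of order less than \<open>n\<close>.\<close>

definition involves_order_ge :: "nat \<Rightarrow> 'n jet rpoly \<Rightarrow> bool"
  where "involves_order_ge n f \<longleftrightarrow>
    \<not> (\<exists>g. f \<approx>\<^sub>J g \<and> (\<forall>v\<in>pvars g. jet_order v < n))"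

end

(* A gauge-invariant polynomial is constant along the translates of the jet space by jets of gauge
   transformations, so it factors through the quotient. A Poincare-type homotopy built from
   contraction with the position vector writes every jet of T as a pure gauge jet plus an explicit
   linear expression in the linearized curvature K = d_c H_eab|f - d_f H_eab|c, where H is the curl
   of T in its antisymmetric pair, and K vanishes on pure gauge jets. Up to a nonzero factor
   depending only on k, E is a component of the derivatives of K: after the column
   antisymmetrizations almost all row permutations drop out. Congruence modulo the index symmetries
   is equality of values on all symmetric jets, so everything can be checked on real arrays. *)

theory Submission
  imports Defs
begin

subsection \<open>Evaluation of polynomials\<close>

text \<open>The obstacle lies in the gauge parameters. Merged into s = \<epsilon> + \<eta> they form
  an arbitrary tensor, and the usual homotopy in the form indices a, b writes T as a curl of u, the
  contraction of T with the position vector, plus a contraction of H. But the gauge transformation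
  also subtracts the c-derivative of s_ab - s_ba, so u cannot simply be taken as s: its
  antisymmetric part counts a second time. A second homotopy, in the index c of H, brings in K, and
  the cyclic identity of T ties together the potentials that the two homotopies leave behind.

  A polynomial contains finitely many variables, so jets of bounded order matter, and parameters
  that are Taylor polynomials realise all of them.

  Membership in the ideal can be tested on values because the relations are linear: a linear
  projection of arbitrary jets onto symmetric ones gives a normal form congruent to the original
  polynomial, and real polynomials with equal values are equal.\<close>

definition mono_eval :: "('v \<Rightarrow> real) \<Rightarrow> ('v \<Rightarrow>\<^sub>0 nat) \<Rightarrow> real"
  where "mono_eval x m = (\<Prod>v\<in>Poly_Mapping.keys m. x v ^ Poly_Mapping.lookup m v)"

definition poly_eval :: "('v \<Rightarrow> real) \<Rightarrow> 'v rpoly \<Rightarrow> real"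
  where "poly_eval x p = (\<Sum>m\<in>Poly_Mapping.keys p. Poly_Mapping.lookup p m * mono_eval x m)"

lemma mono_eval_superset:
  assumes "finite A" "Poly_Mapping.keys m \<subseteq> A"
  shows "mono_eval x m = (\<Prod>v\<in>A. x v ^ Poly_Mapping.lookup m v)"
  unfolding mono_eval_def by (rule prod.mono_neutral_left) (use assms in \<open>auto simp: in_keys_iff\<close>)

lemma mono_eval_0 [simp]: "mono_eval x 0 = 1"
  by (simp add: mono_eval_def)

lemma mono_eval_add: "mono_eval x (m + n) = mono_eval x m * mono_eval x n"
proof -
  let ?A = "Poly_Mapping.keys m \<union> Poly_Mapping.keys n"
  have "Poly_Mapping.keys (m + n) \<subseteq> ?A"
    by (rule Poly_Mapping.keys_add)
  then show ?thesis
    by (subst (1 2 3) mono_eval_superset[of ?A]) (auto simp: lookup_add power_add prod.distrib)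
qed

lemma poly_eval_superset:
  assumes "finite A" "Poly_Mapping.keys p \<subseteq> A"
  shows "poly_eval x p = (\<Sum>m\<in>A. Poly_Mapping.lookup p m * mono_eval x m)"
  unfolding poly_eval_def by (rule sum.mono_neutral_left) (use assms in \<open>auto simp: in_keys_iff\<close>)

lemma poly_eval_add: "poly_eval x (p + q) = poly_eval x p + poly_eval x q"
proof -
  let ?A = "Poly_Mapping.keys p \<union> Poly_Mapping.keys q"
  have "Poly_Mapping.keys (p + q) \<subseteq> ?A"
    by (rule Poly_Mapping.keys_add)
  then show ?thesis
    by (subst (1 2 3) poly_eval_superset[of ?A]) (auto simp: lookup_add ring_distribs sum.distrib)
qed

lemma poly_eval_single: "poly_eval x (Poly_Mapping.single m r) = r * mono_eval x m"
  by (simp add: poly_eval_def)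

lemma poly_eval_0 [simp]: "poly_eval x 0 = 0"
  by (simp add: poly_eval_def)

lemma poly_eval_pconst [simp]: "poly_eval x (pconst r) = r"
  by (simp add: pconst_def poly_eval_single)

lemma poly_eval_pvar [simp]: "poly_eval x (pvar v) = x v"
  by (simp add: pvar_def poly_eval_single mono_eval_def)

lemma poly_eval_sum: "poly_eval x (sum g A) = (\<Sum>a\<in>A. poly_eval x (g a))"
  by (induction A rule: infinite_finite_induct) (auto simp: poly_eval_add)

lemma poly_eval_mult: "poly_eval x (p * q) = poly_eval x p * poly_eval x q"
proof -
  have "poly_eval x (p * q) = poly_eval x
      ((\<Sum>m\<in>Poly_Mapping.keys p. Poly_Mapping.single m (Poly_Mapping.lookup p m)) *
       (\<Sum>m\<in>Poly_Mapping.keys q. Poly_Mapping.single m (Poly_Mapping.lookup q m)))"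
    by (simp only: rpoly_decompose[symmetric])
  also have "\<dots> = poly_eval x p * poly_eval x q"
    by (simp add: sum_product mult_single poly_eval_sum poly_eval_single mono_eval_add
        poly_eval_def[of x p] poly_eval_def[of x q] mult_ac)
  finally show ?thesis .
qed

lemma pconst_1: "pconst 1 = 1"
  by (simp add: pconst_def)

lemma poly_eval_1 [simp]: "poly_eval x 1 = 1"
  using poly_eval_pconst[of x 1] by (simp add: pconst_1)

lemma poly_eval_uminus: "poly_eval x (- p) = - poly_eval x p"
  using poly_eval_add[of x p "- p"] by simp

lemma poly_eval_diff: "poly_eval x (p - q) = poly_eval x p - poly_eval x q"
  using poly_eval_add[of x p "- q"] by (simp add: poly_eval_uminus)

lemma poly_eval_power: "poly_eval x (p ^ n) = poly_eval x p ^ n"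
  by (induction n) (simp_all add: poly_eval_mult)

lemma poly_eval_prod: "poly_eval x (prod g A) = (\<Prod>a\<in>A. poly_eval x (g a))"
  by (induction A rule: infinite_finite_induct) (auto simp: poly_eval_mult)

lemma poly_eval_psubst: "poly_eval x (psubst \<phi> p) = poly_eval (\<lambda>v. poly_eval x (\<phi> v)) p"
  by (simp add: psubst_def poly_eval_sum poly_eval_mult poly_eval_prod poly_eval_power
      poly_eval_def[of _ p] mono_eval_def)

lemma poly_eval_cong:
  assumes "\<And>v. v \<in> pvars p \<Longrightarrow> x v = y v"
  shows "poly_eval x p = poly_eval y p"
proof -
  have "mono_eval x m = mono_eval y m" if "m \<in> Poly_Mapping.keys p" for m
    unfolding mono_eval_def
  proof (rule prod.cong)
    fix v assume "v \<in> Poly_Mapping.keys m"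
    with that have "x v = y v"
      by (intro assms) (auto simp: pvars_def)
    then show "x v ^ Poly_Mapping.lookup m v = y v ^ Poly_Mapping.lookup m v" by simp
  qed simp
  then show ?thesis
    by (simp add: poly_eval_def)
qed

lemma finite_pvars: "finite (pvars p)"
  by (simp add: pvars_def)

lemma pvars_add: "pvars (p + q) \<subseteq> pvars p \<union> pvars q"
  using Poly_Mapping.keys_add[of p q] by (auto simp: pvars_def)

lemma pvars_mult: "pvars (p * q) \<subseteq> pvars p \<union> pvars q"
proof
  fix v assume "v \<in> pvars (p * q)"
  then obtain m where "m \<in> Poly_Mapping.keys (p * q)" and v: "v \<in> Poly_Mapping.keys m"
    by (auto simp: pvars_def)
  then obtain a b where ab: "m = a + b" "a \<in> Poly_Mapping.keys p" "b \<in> Poly_Mapping.keys q"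
    using keys_mult[of p q] by auto
  with v show "v \<in> pvars p \<union> pvars q"
    using Poly_Mapping.keys_add[of a b] by (auto simp: pvars_def)
qed

lemma pvars_pconst [simp]: "pvars (pconst r) = {}"
  by (auto simp: pvars_def pconst_def)

lemma pvars_pvar [simp]: "pvars (pvar v) = {v}"
  by (auto simp: pvars_def pvar_def)

lemma pvars_sum: "pvars (sum g A) \<subseteq> (\<Union>a\<in>A. pvars (g a))"
proof (induction A rule: infinite_finite_induct)
  case (insert a A)
  then show ?case using pvars_add[of "g a" "sum g A"] by auto
qed (simp_all add: pvars_def)

lemma pvars_1 [simp]: "pvars 1 = {}"
  using pvars_pconst[of 1] by (simp add: pconst_1)

lemma pvars_prod: "pvars (prod g A) \<subseteq> (\<Union>a\<in>A. pvars (g a))"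
proof (induction A rule: infinite_finite_induct)
  case (insert a A)
  then show ?case using pvars_mult[of "g a" "prod g A"] by auto
qed simp_all

lemma pvars_power: "pvars (p ^ n) \<subseteq> pvars p"
proof (induction n)
  case (Suc n)
  then show ?case using pvars_mult[of p "p ^ n"] by auto
qed simp

lemma pvars_psubst: "pvars (psubst \<phi> p) \<subseteq> (\<Union>v\<in>pvars p. pvars (\<phi> v))"
proof -
  have *: "pvars (pconst r * (\<Prod>v\<in>A. \<phi> v ^ e v)) \<subseteq> (\<Union>v\<in>A. pvars (\<phi> v))" for r A e
  proof -
    have "pvars (pconst r * (\<Prod>v\<in>A. \<phi> v ^ e v)) \<subseteq> (\<Union>v\<in>A. pvars (\<phi> v ^ e v))"
      using pvars_mult[of "pconst r" "\<Prod>v\<in>A. \<phi> v ^ e v"] pvars_prod[of "\<lambda>v. \<phi> v ^ e v" A] by simp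
    also have "\<dots> \<subseteq> (\<Union>v\<in>A. pvars (\<phi> v))"
      by (rule UN_mono[OF order_refl pvars_power])
    finally show ?thesis .
  qed
  have "pvars (psubst \<phi> p) \<subseteq> (\<Union>m\<in>Poly_Mapping.keys p.
      pvars (pconst (Poly_Mapping.lookup p m) * (\<Prod>v\<in>Poly_Mapping.keys m. \<phi> v ^ Poly_Mapping.lookup m v)))"
    unfolding psubst_def by (rule pvars_sum)
  also have "\<dots> \<subseteq> (\<Union>m\<in>Poly_Mapping.keys p. \<Union>v\<in>Poly_Mapping.keys m. pvars (\<phi> v))"
    using * by (rule UN_mono[OF order_refl])
  also have "\<dots> = (\<Union>v\<in>pvars p. pvars (\<phi> v))"
    by (simp add: pvars_def[of p])
  finally show ?thesis .
qed

lemma psubst_pvar: "psubst pvar p = p"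
proof -
  have pow: "pvar v ^ n = Poly_Mapping.single (Poly_Mapping.single v n) 1" for v :: 'a and n
    by (induction n) (simp_all add: pvar_def mult_single flip: single_add)
  have prod: "(\<Prod>v\<in>A. Poly_Mapping.single (Poly_Mapping.single v (e v)) (1::real)) =
      Poly_Mapping.single (\<Sum>v\<in>A. Poly_Mapping.single v (e v)) 1" for A :: "'a set" and e :: "'a \<Rightarrow> nat"
    by (induction A rule: infinite_finite_induct) (simp_all add: mult_single)
  have "(\<Sum>v\<in>Poly_Mapping.keys m. Poly_Mapping.single v (Poly_Mapping.lookup m v)) = m" for m :: "'a \<Rightarrow>\<^sub>0 nat"
    by (rule poly_mapping_eqI) (auto simp: lookup_sum lookup_single when_def in_keys_iff)
  then have "psubst pvar p = (\<Sum>m\<in>Poly_Mapping.keys p. Poly_Mapping.single m (Poly_Mapping.lookup p m))"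
    by (simp add: psubst_def pow prod pconst_def mult_single)
  then show ?thesis
    using rpoly_decompose[of p] by simp
qed

section \<open>Derivations as derivatives along lines; polynomials as functions\<close>

lemma has_derivative_mono_eval:
  "((\<lambda>t. mono_eval (\<lambda>v. x v + t * w v) m) has_real_derivative
      poly_eval (\<lambda>v. x v + t * w v) (derivation (\<lambda>v. pconst (w v)) (Poly_Mapping.single m 1))) (at t)"
proof -
  let ?y = "\<lambda>t v. x v + t * w v"
  have eq: "mono_eval y (m - Poly_Mapping.single v 1) =
      y v ^ (Poly_Mapping.lookup m v - 1) * (\<Prod>u\<in>Poly_Mapping.keys m - {v}. y u ^ Poly_Mapping.lookup m u)"
    if "v \<in> Poly_Mapping.keys m" for v y
  proof -
    \<comment> \<open>The product runs over the keys of \<open>m\<close> because \<open>v\<close>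
      may leave the support when lowered; exponent 0 then gives a harmless factor 1.\<close>
    have "Poly_Mapping.keys (m - Poly_Mapping.single v 1) \<subseteq> Poly_Mapping.keys m"
      by (auto simp: in_keys_iff lookup_minus)
    then have "mono_eval y (m - Poly_Mapping.single v 1) =
        (\<Prod>u\<in>Poly_Mapping.keys m. y u ^ Poly_Mapping.lookup (m - Poly_Mapping.single v 1) u)"
      by (intro mono_eval_superset) auto
    also have "\<dots> = y v ^ (Poly_Mapping.lookup m v - 1) *
        (\<Prod>u\<in>Poly_Mapping.keys m - {v}. y u ^ Poly_Mapping.lookup m u)"
      using that by (subst prod.remove[of _ v])
        (auto simp: lookup_minus lookup_single intro!: prod.cong)
    finally show ?thesis .
  qed
  have "((\<lambda>t. \<Prod>v\<in>Poly_Mapping.keys m. ?y t v ^ Poly_Mapping.lookup m v) has_real_derivative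
      (\<Sum>v\<in>Poly_Mapping.keys m. (real (Poly_Mapping.lookup m v) * (w v * ?y t v ^ (Poly_Mapping.lookup m v - 1))) *
        (\<Prod>u\<in>Poly_Mapping.keys m - {v}. ?y t u ^ Poly_Mapping.lookup m u))) (at t)"
    by (rule has_field_derivative_prod) (auto intro!: derivative_eq_intros)
  then show ?thesis
    by (simp add: mono_eval_def[symmetric, of _ m] derivation_single poly_eval_sum poly_eval_mult
        poly_eval_single eq[unfolded One_nat_def] mult_ac)
qed

text \<open>With constant coefficients \<open>w v\<close> a derivation is a directional derivative.
  This turns vanishing of the gauge variation into constancy along lines in jet space.\<close>

lemma has_derivative_poly_eval:
  "((\<lambda>t. poly_eval (\<lambda>v. x v + t * w v) p) has_real_derivative
      poly_eval (\<lambda>v. x v + t * w v) (derivation (\<lambda>v. pconst (w v)) p)) (at t)"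
proof -
  have single: "Poly_Mapping.single m r = pconst r * Poly_Mapping.single m 1" for m :: "'a \<Rightarrow>\<^sub>0 nat" and r
    by (simp add: pconst_def mult_single)
  have "poly_eval y (derivation \<phi> p) = (\<Sum>m\<in>Poly_Mapping.keys p. Poly_Mapping.lookup p m *
      poly_eval y (derivation \<phi> (Poly_Mapping.single m 1)))" for y \<phi>
  proof -
    have "derivation \<phi> (\<Sum>m\<in>A. Poly_Mapping.single m (r m)) =
        (\<Sum>m\<in>A. pconst (r m) * derivation \<phi> (Poly_Mapping.single m 1))" for A :: "('a \<Rightarrow>\<^sub>0 nat) set" and r
    proof -
      have "derivation \<phi> (Poly_Mapping.single m (r m)) = pconst (r m) * derivation \<phi> (Poly_Mapping.single m 1)" for m
        unfolding single[of m "r m"] derivation_mult by simp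
      then show ?thesis
        by (simp add: derivation_sum)
    qed
    from this[where A = "Poly_Mapping.keys p" and r = "Poly_Mapping.lookup p"] show ?thesis
      by (simp only: rpoly_decompose[symmetric]) (simp add: poly_eval_sum poly_eval_mult)
  qed
  then show ?thesis
    by (simp only: poly_eval_def[of _ p]) (intro DERIV_sum DERIV_cmult has_derivative_mono_eval)
qed

text \<open>Induction on the degree of the monomial \<open>m\<close>, with no bound on the number of
  variables: the constant coefficient is the value at the origin; otherwise differentiation in a
  variable of \<open>m\<close> lowers the degree and multiplies the coefficient by a nonzero
  exponent.\<close>

lemma poly_eval_eq_0_imp_0:
  assumes "\<And>x. poly_eval x p = 0"
  shows "p = 0"
proof -
  define deg where "deg m = (\<Sum>v\<in>Poly_Mapping.keys m. Poly_Mapping.lookup m v)" for m :: "'a \<Rightarrow>\<^sub>0 nat"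
  have "Poly_Mapping.lookup p m = 0" for m
    using assms
  proof (induction "deg m" arbitrary: m p rule: less_induct)
    case less
    show ?case
    proof (cases "m = 0")
      case True
      have "mono_eval (\<lambda>_. 0) n = (if n = 0 then 1 else 0)" for n :: "'a \<Rightarrow>\<^sub>0 nat"
      proof -
        have "\<exists>v\<in>Poly_Mapping.keys n. Poly_Mapping.lookup n v \<noteq> 0" if "n \<noteq> 0"
          using that by (auto simp: poly_mapping_eq_iff in_keys_iff fun_eq_iff)
        then show ?thesis
          by (auto simp: mono_eval_def power_0_left intro!: prod_zero)
      qed
      then have "poly_eval (\<lambda>_. 0) p = (\<Sum>n\<in>Poly_Mapping.keys p. if n = 0 then Poly_Mapping.lookup p n else 0)"
        unfolding poly_eval_def by (intro sum.cong) auto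
      then show ?thesis
        using less.prems[of "\<lambda>_. 0"] True by (auto simp: in_keys_iff split: if_splits)
    next
      case False
      then obtain v where v: "Poly_Mapping.lookup m v \<noteq> 0"
        by (auto simp: poly_mapping_eq_iff fun_eq_iff)
      define w :: "'a \<Rightarrow> real" where "w u = (if u = v then 1 else 0)" for u
      define m' where "m' = m - Poly_Mapping.single v 1"
      define q where "q = derivation (\<lambda>v. pconst (w v)) p"
      have m: "m = m' + Poly_Mapping.single v 1"
        using v by (intro poly_mapping_eqI) (auto simp: m'_def lookup_add lookup_minus lookup_single when_def)
      have q0: "poly_eval x q = 0" for x
        using has_derivative_poly_eval[of x w p 0] less.prems
        by (auto simp: q_def dest: DERIV_unique[OF _ DERIV_const])
      have "deg m' = (\<Sum>u\<in>Poly_Mapping.keys m. Poly_Mapping.lookup m' u)"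
        unfolding deg_def by (rule sum.mono_neutral_left) (auto simp: m'_def in_keys_iff lookup_minus)
      also have "\<dots> < deg m"
        unfolding deg_def using v
        by (intro sum_strict_mono_ex1) (auto simp: m'_def in_keys_iff lookup_minus intro!: bexI[of _ v])
      finally have "deg m' < deg m" .
      then have "Poly_Mapping.lookup q m' = 0"
        using less.hyps q0 by blast
      moreover have "Poly_Mapping.lookup q m' = Poly_Mapping.lookup p m * real (Poly_Mapping.lookup m v)"
      proof -
        \<comment> \<open>Only \<open>n = m\<close>, \<open>u = v\<close> lowers to
          \<open>m'\<close>; membership of \<open>u\<close> in the keys of \<open>n\<close> excludes
          truncated subtraction.\<close>
        have n: "Poly_Mapping.lookup (Poly_Mapping.single (n - Poly_Mapping.single u 1) r * pconst (w u)) m' =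
            (if u = v then (if n = m then r else 0) else 0)" if "u \<in> Poly_Mapping.keys n" for n u r
        proof (cases "u = v")
          case True
          have "n = m \<longleftrightarrow> n - Poly_Mapping.single v 1 = m'"
          proof
            assume *: "n - Poly_Mapping.single v 1 = m'"
            have "n = n - Poly_Mapping.single v 1 + Poly_Mapping.single v 1"
              using that True by (intro poly_mapping_eqI)
                (auto simp: lookup_add lookup_minus lookup_single when_def in_keys_iff)
            then show "n = m" using * m by simp
          qed (simp add: m'_def)
          then show ?thesis
            using True by (simp add: w_def pconst_def mult_single lookup_single when_def)
        qed (simp add: w_def pconst_def)
        have "Poly_Mapping.lookup q m' = (\<Sum>n\<in>Poly_Mapping.keys p. \<Sum>u\<in>Poly_Mapping.keys n.
            (if u = v then (if n = m then Poly_Mapping.lookup p n * real (Poly_Mapping.lookup n u) else 0) else 0))"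
          unfolding q_def derivation_def lookup_sum by (intro sum.cong refl n)
        also have "\<dots> = (\<Sum>n\<in>Poly_Mapping.keys p. if n = m then Poly_Mapping.lookup p m * real (Poly_Mapping.lookup m v) else 0)"
          using v by (intro sum.cong refl) (auto simp: in_keys_iff)
        also have "\<dots> = Poly_Mapping.lookup p m * real (Poly_Mapping.lookup m v)"
          by (auto simp: in_keys_iff)
        finally show ?thesis .
      qed
      ultimately show ?thesis using v by simp
    qed
  qed
  then show ?thesis by (intro poly_mapping_eqI) simp
qed

subsection \<open>Gauge fixing of jets\<close>

text \<open>This is the derivative along \<open>M\<close>, at the origin, of x^a A_a: since x
  vanishes there, exactly one derivative must hit x^a, and each element of \<open>M\<close> supplies
  one such term.\<close>

definition contr :: "('n \<Rightarrow> 'n multiset \<Rightarrow> real) \<Rightarrow> 'n multiset \<Rightarrow> real"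
  where "contr A M = (\<Sum>a\<in>#M. A a (M - {#a#}))"

lemma contr_empty [simp]: "contr A {#} = 0"
  by (simp add: contr_def)

text \<open>Leibniz rule: the additional derivative hits either x^d or the array.\<close>

lemma contr_add_mset:
  "contr A (add_mset d M) = A d M + contr (\<lambda>a M. A a (add_mset d M)) M"
proof -
  have "image_mset (\<lambda>a. A a (add_mset d M - {#a#})) M = image_mset (\<lambda>a. A a (add_mset d (M - {#a#}))) M"
    by (rule image_mset_cong) simp
  then show ?thesis
    by (simp add: contr_def)
qed

text \<open>Euler's identity: x^a \<partial>_a multiplies jets of order k by k.\<close>

lemma contr_derivative: "contr (\<lambda>a M. B (add_mset a M)) M = real (size M) * B M"
proof -
  have "image_mset (\<lambda>a. B (add_mset a (M - {#a#}))) M = image_mset (\<lambda>_. B M) M"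
    by (rule image_mset_cong) simp
  then show ?thesis
    by (simp add: contr_def)
qed

lemma contr_cong:
  assumes "\<And>a K. M = add_mset a K \<Longrightarrow> A a K = B a K"
  shows "contr A M = contr B M"
  unfolding contr_def
  by (rule arg_cong[where f = sum_mset], rule image_mset_cong) (metis assms insert_DiffM)

lemma contr_plus: "contr (\<lambda>a M. A a M + B a M) M = contr A M + contr B M"
  by (simp add: contr_def sum_mset.distrib)

lemma contr_scale: "contr (\<lambda>a M. c * A a M) M = c * contr A M"
  by (simp add: contr_def sum_mset_distrib_left)

lemma contr_minus: "contr (\<lambda>a M. A a M - B a M) M = contr A M - contr B M"
  using contr_plus[of A "\<lambda>a M. - 1 * B a M" M] contr_scale[of "-1" B M] by simp

lemma contr_commute:
  "contr (\<lambda>e. contr (\<lambda>f. A e f)) M = contr (\<lambda>f. contr (\<lambda>e. A e f)) M"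
proof (induction M arbitrary: A)
  case (add d M)
  show ?case
    using add.IH[of "\<lambda>e f K. A e f (add_mset d K)"] by (simp add: contr_add_mset contr_plus)
qed simp

text \<open>An array \<open>T a b c M\<close> stands for \<open>\<partial>\<^bsub>M\<^esub> T\<^bsub>[ab]c\<^esub>\<close>, and
  \<open>s b c M\<close> for \<open>\<partial>\<^bsub>M\<^esub> (\<epsilon>\<^bsub>bc\<^esub> + \<eta>\<^bsub>bc\<^esub>)\<close>.\<close>

type_synonym 'n hook_array = "'n \<Rightarrow> 'n \<Rightarrow> 'n \<Rightarrow> 'n multiset \<Rightarrow> real"

definition gauge_array :: "('n \<Rightarrow> 'n \<Rightarrow> 'n multiset \<Rightarrow> real) \<Rightarrow> 'n hook_array"
  where "gauge_array s a b c M =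
    s b c (add_mset a M) - s a c (add_mset b M) - (s a b (add_mset c M) - s b a (add_mset c M))"

definition field_strength :: "'n hook_array \<Rightarrow> 'n \<Rightarrow> 'n hook_array"
  where "field_strength T e a b c M =
    T a b c (add_mset e M) + T b e c (add_mset a M) + T e a c (add_mset b M)"

definition curvature :: "'n hook_array \<Rightarrow> 'n \<Rightarrow> 'n \<Rightarrow> 'n \<Rightarrow> 'n \<Rightarrow> 'n \<Rightarrow> 'n multiset \<Rightarrow> real"
  where "curvature T e a b c f M =
    field_strength T e a b f (add_mset c M) - field_strength T e a b c (add_mset f M)"

definition hook_symmetric :: "'n hook_array \<Rightarrow> bool"
  where "hook_symmetric T \<longleftrightarrow>
    (\<forall>a b c M. T b a c M = - T a b c M \<and> T a b c M + T c a b M + T b c a M = 0)"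

text \<open>The curl in a, b kills the first two terms of the gauge transformation and turns the
  third into a c-derivative, which the curl in c, f kills.\<close>

lemma curvature_gauge_array: "curvature (gauge_array s) e a b c f M = 0"
  by (simp add: curvature_def field_strength_def gauge_array_def add_mset_commute)

definition curvature_contr :: "'n hook_array \<Rightarrow> 'n hook_array"
  where "curvature_contr T a b c M =
    contr (\<lambda>e. contr (\<lambda>f. curvature T e a b c f)) M"

text \<open>The part of T that the homotopies express through the twice contracted curvature. The
  factor \<open>size M + 2\<close> comes from the homotopy for the two-form indices a, b, the factor
  \<open>size M\<close> from the one for the index c, and \<open>size M + 3\<close> from solving for
  a three-form. At \<open>M = {#}\<close> division by zero gives the intended value 0.\<close>

definition hook_residue :: "'n hook_array \<Rightarrow> 'n hook_array"
  where "hook_residue T a b c M =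
    ((curvature_contr T a b c M + curvature_contr T b c a M + curvature_contr T c a b M)
       / (real (size M) + 3) - curvature_contr T a b c M)
    / (real (size M) * (real (size M) + 2))"

lemma gauge_fixing:
  assumes T: "hook_symmetric T"
  shows "\<exists>s. \<forall>a b c M. T a b c M = gauge_array s a b c M + hook_residue T a b c M"
proof -
  have anti: "T b a c M = - T a b c M" for a b c M
    using T unfolding hook_symmetric_def by blast
  have cyc: "T a b c M + T c a b M + T b c a M = 0" for a b c M
    using T unfolding hook_symmetric_def by blast
  let ?H = "field_strength T"
  define u where "u b c = contr (\<lambda>a. T a b c)" for b c
  define v where "v a b = contr (\<lambda>e. T a b e)" for a b
  define w where "w b = contr (\<lambda>f. u b f)" for b
  define B where "B e a b = contr (\<lambda>f. ?H e a b f)" for e a b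
  define \<beta> where "\<beta> a b = contr (\<lambda>e. B e a b)" for a b
  define Z where "Z a b c = contr (\<lambda>e. ?H e a b c)" for a b c
  define Q where "Q = curvature_contr T"
  \<comment> \<open>\<open>k\<close> is the order of the jet of T, one less than that of the
    parameter. The \<beta> term absorbs the part of \<open>Z\<close> that is a curl in a, b. The
    \<open>w\<close> term is a gradient in its first index, hence invisible to that curl, and
    cancels the derivatives of \<open>w\<close> that enter through the antisymmetric part of
    \<open>u\<close>. What then remains of the antisymmetric part of \<open>s\<close> matches the
    c-derivative of \<beta> left over in \<open>Z\<close>.\<close>
  define s where "s b c N = (let k = real (size N) - 1 in
     (u b c N - \<beta> b c N / (k * (k + 3)) + w c (add_mset b N) / (k + 3)) / (k + 2))" for b c N
  have u_anti: "u a b M - u b a M = - v a b M" for a b M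
  proof -
    have "u a b M - u b a M + v a b M = contr (\<lambda>e M. T e a b M - T e b a M + T a b e M) M"
      by (simp add: u_def v_def contr_plus contr_minus)
    also have "\<dots> = contr (\<lambda>e M. 0 * T e a b M) M"
    proof (rule contr_cong)
      show "T e a b K - T e b a K + T a b e K = 0 * T e a b K" for e K
        using cyc[of e a b K] anti[of b e a K] by simp
    qed
    finally show ?thesis by (simp add: contr_def)
  qed
  \<comment> \<open>Cartan's formula for the Euler field, with c as a spectator: the Lie derivative
    of a two-form contributes its degree 2 besides the order of the jet.\<close>
  have TZ: "(real (size M) + 2) * T a b c M = u b c (add_mset a M) - u a c (add_mset b M) + Z a b c M" for a b c M
  proof -
    have "Z a b c M + contr (\<lambda>e M. T e b c (add_mset a M)) M - contr (\<lambda>e M. T e a c (add_mset b M)) M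
      = contr (\<lambda>e M. T a b c (add_mset e M)) M"
      unfolding Z_def contr_plus[symmetric] contr_minus[symmetric]
    proof (rule contr_cong)
      show "field_strength T e a b c K + T e b c (add_mset a K) - T e a c (add_mset b K) = T a b c (add_mset e K)" for e K
        using anti[of e b c "add_mset a K"] by (simp add: field_strength_def)
    qed
    also have "\<dots> = real (size M) * T a b c M"
      by (rule contr_derivative)
    finally show ?thesis
      using anti[of b a c M] by (simp add: u_def contr_add_mset algebra_simps)
  qed
  have H_rotate: "?H e a b = ?H a b e" for e a b
    by (intro ext) (simp add: field_strength_def)
  \<comment> \<open>The total antisymmetrization of T vanishes, hence so does that of
    \<open>?H\<close> over its four indices.\<close>
  have H_cyc: "?H c a b f M = ?H f a b c M + ?H f b c a M + ?H f c a b M" for a b c f M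
    using cyc[of a b c "add_mset f M"] cyc[of a b f "add_mset c M"] cyc[of b c f "add_mset a M"] cyc[of c a f "add_mset b M"]
      anti[of a f _ "add_mset _ M"] anti[of b f _ "add_mset _ M"] anti[of c f _ "add_mset _ M"]
    by (simp add: field_strength_def)
  have B_cyc: "B c a b M = Z a b c M + Z b c a M + Z c a b M" for a b c M
    unfolding B_def Z_def contr_plus[symmetric] H_cyc[of c a b] ..
  \<comment> \<open>Homotopy in the one-form index c of \<open>?H\<close>, contracted once more over
    e. The c-derivative does not commute with that contraction; the correction is
    \<open>B c a b\<close>.\<close>
  have Z_eq: "real (size M) * Z a b c M = \<beta> a b (add_mset c M) - B c a b M - Q a b c M" for a b c M
  proof -
    have H: "real (size M) * ?H e a b c K = B e a b (add_mset c K) - contr (\<lambda>f. curvature T e a b c f) K"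
      if "M = add_mset e K" for e K
    proof -
      have "B e a b (add_mset c K) - contr (\<lambda>f. curvature T e a b c f) K
         = ?H e a b c K + contr (\<lambda>f K. ?H e a b f (add_mset c K) - curvature T e a b c f K) K"
        by (simp add: B_def contr_add_mset contr_minus)
      also have "contr (\<lambda>f K. ?H e a b f (add_mset c K) - curvature T e a b c f K) K
         = contr (\<lambda>f K. ?H e a b c (add_mset f K)) K"
        by (simp add: curvature_def)
      also have "\<dots> = real (size K) * ?H e a b c K"
        by (rule contr_derivative)
      finally show ?thesis using that by (simp add: algebra_simps)
    qed
    have "real (size M) * Z a b c M = contr (\<lambda>e K. B e a b (add_mset c K) - contr (\<lambda>f. curvature T e a b c f) K) M"
      unfolding Z_def contr_scale[symmetric] by (intro contr_cong) (use H in simp)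
    then show ?thesis
      by (simp add: \<beta>_def contr_add_mset contr_minus Q_def curvature_contr_def)
  qed
  \<comment> \<open>Inserting \<open>Z_eq\<close> into \<open>B_cyc\<close> yields three rotated
    copies of \<open>B\<close>, equal to one another; moved to the left they turn
    \<open>size M\<close> into \<open>size M + 3\<close>.\<close>
  have B_eq: "(real (size M) + 3) * B c a b M = \<beta> a b (add_mset c M) + \<beta> b c (add_mset a M) + \<beta> c a (add_mset b M)
       - (Q a b c M + Q b c a M + Q c a b M)" for a b c M
  proof -
    have rot: "B a b c M = B c a b M" "B b c a M = B c a b M"
      by (simp_all add: B_def H_rotate[of c a b] H_rotate[of b c a])
    have "real (size M) * B c a b M =
      real (size M) * Z a b c M + real (size M) * Z b c a M + real (size M) * Z c a b M"
      by (simp add: B_cyc distrib_left)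
    then show ?thesis
      unfolding Z_eq rot by (simp add: algebra_simps)
  qed
  \<comment> \<open>The link between the two homotopies: contracting in the other order, \<beta> is
    a contraction of \<open>Z\<close>, which \<open>TZ\<close> expresses by T and \<open>u\<close>.
    Inside the contraction one derivative is used up, so \<open>size M + 2\<close> becomes
    \<open>size M + 1\<close>; \<open>u_anti\<close> restores it.\<close>
  have \<beta>_eq: "\<beta> a b M = (real (size M) + 2) * v a b M - w b (add_mset a M) + w a (add_mset b M)" for a b M
  proof -
    have "\<beta> a b M = contr (\<lambda>f. Z a b f) M"
      unfolding \<beta>_def B_def Z_def by (rule contr_commute)
    also have "\<dots> = contr (\<lambda>f K. (real (size M) + 1) * T a b f K - u b f (add_mset a K) + u a f (add_mset b K)) M"
    proof (rule contr_cong)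
      show "Z a b f K = (real (size M) + 1) * T a b f K - u b f (add_mset a K) + u a f (add_mset b K)"
        if "M = add_mset f K" for f K
        using TZ[of K a b f] that by (simp add: algebra_simps)
    qed
    also have "\<dots> = (real (size M) + 1) * v a b M - (w b (add_mset a M) - u b a M) + (w a (add_mset b M) - u a b M)"
      by (simp add: contr_plus contr_minus contr_scale v_def w_def contr_add_mset)
    finally show ?thesis
      using u_anti[of a b M] by (simp add: algebra_simps)
  qed
  have v_anti: "v b a M = - v a b M" for a b M
    unfolding v_def anti[of b a] using contr_scale[of "-1" "T a b" M] by simp
  have \<beta>_anti: "\<beta> b a M = - \<beta> a b M" for a b M
    by (simp add: \<beta>_eq v_anti[of a b])
  have "T a b c M = gauge_array s a b c M + hook_residue T a b c M" for a b c M
  proof (cases "M = {#}")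
    \<comment> \<open>Here \<open>k = 0\<close>, so the quotient of \<beta> in \<open>s\<close> is 0
      by convention; this is harmless since \<beta> vanishes on a single derivative.\<close>
    case True
    have \<beta>_0: "\<beta> a b {#c#} = 0" for a b c
      by (simp add: \<beta>_def contr_add_mset B_def)
    moreover have "Z a b c {#} = 0"
      by (simp add: Z_def)
    moreover have "hook_residue T a b c M = 0"
      by (simp add: True hook_residue_def)
    moreover have "2 * T a b c {#} = u b c {#a#} - u a c {#b#} + Z a b c {#}"
      using TZ[of "{#}" a b c] by simp
    moreover have "u b a {#c#} = u a b {#c#} + (w b {#a, c#} - w a {#b, c#}) / 3"
      using u_anti[of a b "{#c#}"] \<beta>_eq[of a b "{#c#}"] \<beta>_0[of a b c] by (simp add: field_simps)
    ultimately show ?thesis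
      by (simp add: True gauge_array_def s_def add_mset_commute field_simps)
  next
    case False
    define k where "k = real (size M)"
    have k: "k > 0"
      using False by (simp add: k_def nonempty_has_size)
    have 1: "T a b c M = (u b c (add_mset a M) - u a c (add_mset b M) + Z a b c M) / (k + 2)"
      using TZ[of M a b c, folded k_def] k by (simp add: field_simps)
    have 2: "Z a b c M = (\<beta> a b (add_mset c M) - B c a b M - Q a b c M) / k"
      using Z_eq[of M a b c, folded k_def] k by (simp add: field_simps)
    have 3: "B c a b M = (\<beta> a b (add_mset c M) + \<beta> b c (add_mset a M) + \<beta> c a (add_mset b M)
       - (Q a b c M + Q b c a M + Q c a b M)) / (k + 3)"
      using B_eq[of M c a b, folded k_def] k by (simp add: field_simps)
    have "v a b (add_mset c M) = (\<beta> a b (add_mset c M)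
       + w b (add_mset a (add_mset c M)) - w a (add_mset b (add_mset c M))) / (k + 3)"
      using \<beta>_eq[of a b "add_mset c M", simplified, folded k_def] k by (simp add: field_simps)
    then have 4: "u b a (add_mset c M) = u a b (add_mset c M) + (\<beta> a b (add_mset c M)
       + w b (add_mset a (add_mset c M)) - w a (add_mset b (add_mset c M))) / (k + 3)"
      using u_anti[of a b "add_mset c M"] by simp
    have s: "s b c (add_mset d M) = (u b c (add_mset d M) - \<beta> b c (add_mset d M) / (k * (k + 3))
       + w c (add_mset b (add_mset d M)) / (k + 3)) / (k + 2)" for b c d
      by (simp add: s_def k_def Let_def)
    have "T a b c M - gauge_array s a b c M = hook_residue T a b c M"
      unfolding gauge_array_def s hook_residue_def Q_def[symmetric] k_def[symmetric] 1 2 3 4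
        \<beta>_anti[of a b] \<beta>_anti[of c a] add_mset_commute[of a b] add_mset_commute[of c a] add_mset_commute[of c b]
      using k by (simp add: divide_simps) algebra
    then show ?thesis by simp
  qed
  then show ?thesis by blast
qed

subsection \<open>Congruence of jet polynomials as equality on symmetric jets\<close>

definition jet_symmetric :: "('n jet \<Rightarrow> real) \<Rightarrow> bool"
  where "jet_symmetric J \<longleftrightarrow>
    (\<forall>a b c ds ds'. mset ds = mset ds' \<longrightarrow> J (Jet a b c ds) = J (Jet a b c ds')) \<and>
    (\<forall>a b c ds. J (Jet b a c ds) = - J (Jet a b c ds)) \<and>
    (\<forall>a b c ds. J (Jet a b c ds) + J (Jet c a b ds) + J (Jet b c a ds) = 0)"

lemma
  assumes "jet_symmetric J"
  shows jet_symmetric_perm: "mset ds = mset ds' \<Longrightarrow> J (Jet a b c ds) = J (Jet a b c ds')"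
    and jet_symmetric_antisym: "J (Jet b a c ds) = - J (Jet a b c ds)"
    and jet_symmetric_cyclic: "J (Jet a b c ds) + J (Jet c a b ds) + J (Jet b c a ds) = 0"
  using assms unfolding jet_symmetric_def by blast+

lemma jet_symmetric_add_scaled:
  assumes J: "jet_symmetric J" and K: "jet_symmetric K"
  shows "jet_symmetric (\<lambda>v. J v + t * K v)"
  unfolding jet_symmetric_def
proof (intro conjI allI impI)
  fix a b c :: 'a and ds ds'
  show "J (Jet a b c ds) + t * K (Jet a b c ds) = J (Jet a b c ds') + t * K (Jet a b c ds')"
    if "mset ds = mset ds'"
    using jet_symmetric_perm[OF J that, of a b c] jet_symmetric_perm[OF K that, of a b c] by simp
  show "J (Jet b a c ds) + t * K (Jet b a c ds) = - (J (Jet a b c ds) + t * K (Jet a b c ds))"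
    using jet_symmetric_antisym[OF J, of b a c ds] jet_symmetric_antisym[OF K, of b a c ds] by simp
  have "J (Jet a b c ds) + t * K (Jet a b c ds) + (J (Jet c a b ds) + t * K (Jet c a b ds)) +
      (J (Jet b c a ds) + t * K (Jet b c a ds)) =
      (J (Jet a b c ds) + J (Jet c a b ds) + J (Jet b c a ds)) +
      t * (K (Jet a b c ds) + K (Jet c a b ds) + K (Jet b c a ds))"
    by (simp add: algebra_simps)
  also have "\<dots> = 0"
    by (simp add: jet_symmetric_cyclic[OF J] jet_symmetric_cyclic[OF K])
  finally show "J (Jet a b c ds) + t * K (Jet a b c ds) + (J (Jet c a b ds) + t * K (Jet c a b ds)) +
      (J (Jet b c a ds) + t * K (Jet b c a ds)) = 0" .
qed

text \<open>An arbitrary representative is chosen because the index type carries no order.\<close>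

definition list_of_mset :: "'a multiset \<Rightarrow> 'a list"
  where "list_of_mset M = (SOME xs. mset xs = M)"

lemma mset_list_of_mset [simp]: "mset (list_of_mset M) = M"
  unfolding list_of_mset_def by (rule someI_ex) (rule ex_mset)

definition jet_array :: "('n jet \<Rightarrow> real) \<Rightarrow> 'n hook_array"
  where "jet_array J a b c M = J (Jet a b c (list_of_mset M))"

lemma jet_array_mset:
  assumes "jet_symmetric J"
  shows "jet_array J a b c (mset ds) = J (Jet a b c ds)"
  unfolding jet_array_def by (rule jet_symmetric_perm[OF assms]) simp

lemma hook_symmetric_jet_array:
  assumes "jet_symmetric J"
  shows "hook_symmetric (jet_array J)"
  unfolding hook_symmetric_def jet_array_def
  using jet_symmetric_antisym[OF assms] jet_symmetric_cyclic[OF assms] by blast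

section \<open>The congruence of jet polynomials and its normal form\<close>

lemma module_rpoly: "module ((*) :: 'v rpoly \<Rightarrow> 'v rpoly \<Rightarrow> 'v rpoly)"
  by unfold_locales (auto simp: algebra_simps)

lemma jet_eq_refl [simp]: "p \<approx>\<^sub>J p"
  by (simp add: jet_eq_def jet_ideal_def module.span_zero[OF module_rpoly])

lemma jet_eq_sym: "p \<approx>\<^sub>J q \<Longrightarrow> q \<approx>\<^sub>J p"
  using module.span_neg[OF module_rpoly, of "p - q"] by (simp add: jet_eq_def jet_ideal_def)

lemma jet_eq_add: "p \<approx>\<^sub>J q \<Longrightarrow> p' \<approx>\<^sub>J q' \<Longrightarrow> p + p' \<approx>\<^sub>J q + q'"
  using module.span_add[OF module_rpoly, of "p - q" _ "p' - q'"]
  by (simp add: jet_eq_def jet_ideal_def algebra_simps)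

lemma jet_eq_trans [trans]: "p \<approx>\<^sub>J q \<Longrightarrow> q \<approx>\<^sub>J r \<Longrightarrow> p \<approx>\<^sub>J r"
  using module.span_add[OF module_rpoly, of "p - q" _ "q - r"]
  by (simp add: jet_eq_def jet_ideal_def)

lemma jet_eq_mult:
  assumes "p \<approx>\<^sub>J q" "p' \<approx>\<^sub>J q'"
  shows "p * p' \<approx>\<^sub>J q * q'"
proof -
  have "p' * (p - q) + q * (p' - q') \<in> jet_ideal"
    using assms unfolding jet_eq_def jet_ideal_def
    by (intro module.span_add[OF module_rpoly] module.span_scale[OF module_rpoly])
  then show ?thesis
    by (simp add: jet_eq_def algebra_simps)
qed

lemma jet_eq_diff:
  assumes "p \<approx>\<^sub>J q" "p' \<approx>\<^sub>J q'"
  shows "p - p' \<approx>\<^sub>J q - q'"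
  using jet_eq_add[OF assms(1) jet_eq_mult[OF jet_eq_refl[of "- 1"] assms(2)]] by simp

lemma jet_eq_sum: "(\<And>a. a \<in> A \<Longrightarrow> g a \<approx>\<^sub>J h a) \<Longrightarrow> sum g A \<approx>\<^sub>J sum h A"
  by (induction A rule: infinite_finite_induct) (auto intro: jet_eq_add)

lemma jet_eq_prod: "(\<And>a. a \<in> A \<Longrightarrow> g a \<approx>\<^sub>J h a) \<Longrightarrow> prod g A \<approx>\<^sub>J prod h A"
  by (induction A rule: infinite_finite_induct) (auto intro: jet_eq_mult)

lemma jet_eq_power: "p \<approx>\<^sub>J q \<Longrightarrow> p ^ n \<approx>\<^sub>J q ^ n"
  by (induction n) (auto intro: jet_eq_mult)

lemma jet_eq_psubst:
  assumes "\<And>v. \<phi> v \<approx>\<^sub>J \<psi> v"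
  shows "psubst \<phi> p \<approx>\<^sub>J psubst \<psi> p"
  unfolding psubst_def by (intro jet_eq_sum jet_eq_mult jet_eq_prod jet_eq_power jet_eq_refl assms)

lemma jet_eq_relation: "p - q \<in> jet_relations \<Longrightarrow> p \<approx>\<^sub>J q"
  by (simp add: jet_eq_def jet_ideal_def module.span_base[OF module_rpoly])

lemma jet_eq_imp_poly_eval_eq:
  assumes "p \<approx>\<^sub>J q" "jet_symmetric J"
  shows "poly_eval J p = poly_eval J q"
proof -
  have "poly_eval J r = 0" if "r \<in> jet_ideal" for r
    using that unfolding jet_ideal_def
  proof (induction rule: module.span_induct_alt[OF module_rpoly, consumes 1, case_names base step])
    case (step c x y)
    from step(1) consider
      (perm) a b c ds ds' where "x = pvar (Jet a b c ds) - pvar (Jet a b c ds')" "mset ds = mset ds'"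
      | (antisym) a b c ds where "x = pvar (Jet a b c ds) + pvar (Jet b a c ds)"
      | (cyclic) a b c ds where "x = pvar (Jet a b c ds) + pvar (Jet c a b ds) + pvar (Jet b c a ds)"
      unfolding jet_relations_def by blast
    then have "poly_eval J x = 0"
    proof cases
      case perm
      then show ?thesis
        using jet_symmetric_perm[OF assms(2) perm(2)] by (simp add: poly_eval_diff)
    next
      case antisym
      then show ?thesis
        by (simp add: poly_eval_add jet_symmetric_antisym[OF assms(2), where a = a and b = b])
    next
      case cyclic
      then show ?thesis
        by (simp add: poly_eval_add jet_symmetric_cyclic[OF assms(2)])
    qed
    then show ?case
      using step by (simp add: poly_eval_add poly_eval_mult)
  qed simp
  from this[of "p - q"] assms(1) show ?thesis
    by (simp add: jet_eq_def poly_eval_diff)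
qed

definition jet_antisym :: "'n jet \<Rightarrow> 'n jet rpoly"
  where "jet_antisym v = (case v of Jet a b c ds \<Rightarrow> pconst (1/2) *
    (pvar (Jet a b c (list_of_mset (mset ds))) - pvar (Jet b a c (list_of_mset (mset ds)))))"

text \<open>A linear projection onto symmetric jets: the subtracted term is the totally
  antisymmetric part, which the cyclic relation annihilates.\<close>

definition jet_normal_form :: "'n jet \<Rightarrow> 'n jet rpoly"
  where "jet_normal_form v = (case v of Jet a b c ds \<Rightarrow> jet_antisym (Jet a b c ds) -
    pconst (1/3) * (jet_antisym (Jet a b c ds) + jet_antisym (Jet c a b ds) + jet_antisym (Jet b c a ds)))"

lemma jet_symmetric_normal_form: "jet_symmetric (\<lambda>v. poly_eval J (jet_normal_form v))"
  unfolding jet_symmetric_def jet_normal_form_def jet_antisym_def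
  by (auto simp: poly_eval_diff poly_eval_add poly_eval_mult algebra_simps)

lemma jet_normal_form_eq: "pvar v \<approx>\<^sub>J jet_normal_form v"
proof -
  have antisym: "jet_antisym (Jet a b c ds) \<approx>\<^sub>J pvar (Jet a b c ds)" for a b c :: 'a and ds
  proof -
    let ?ds = "list_of_mset (mset ds)"
    have perm: "pvar (Jet a b c ?ds) \<approx>\<^sub>J pvar (Jet a b c ds)" for a b c
      by (rule jet_eq_relation) (unfold jet_relations_def, rule UnI1, rule UnI1, simp, metis mset_list_of_mset)
    have "pvar (Jet b a c ds) \<approx>\<^sub>J - pvar (Jet a b c ds)"
      by (rule jet_eq_relation) (unfold jet_relations_def, rule UnI1, rule UnI2, simp, metis)
    then have "jet_antisym (Jet a b c ds) \<approx>\<^sub>J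
        pconst (1/2) * (pvar (Jet a b c ds) - (- pvar (Jet a b c ds)))"
      unfolding jet_antisym_def jet.case
      by (rule jet_eq_mult[OF jet_eq_refl jet_eq_diff[OF perm jet_eq_trans[OF perm]]])
    also have "pconst (1/2) * (pvar (Jet a b c ds) - (- pvar (Jet a b c ds))) = pvar (Jet a b c ds)"
      by (simp add: pconst_def pvar_def mult_single flip: single_add)
    finally show ?thesis .
  qed
  obtain a b c ds where v: "v = Jet a b c ds"
    by (cases v)
  have "pvar (Jet a b c ds) + pvar (Jet c a b ds) + pvar (Jet b c a ds) \<approx>\<^sub>J 0"
    by (rule jet_eq_relation) (unfold jet_relations_def, rule UnI2, simp, metis)
  then have *: "jet_antisym (Jet a b c ds) + jet_antisym (Jet c a b ds) + jet_antisym (Jet b c a ds) \<approx>\<^sub>J 0"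
    by (rule jet_eq_trans[OF jet_eq_add[OF jet_eq_add[OF antisym antisym] antisym]])
  have "jet_normal_form v \<approx>\<^sub>J pvar v - pconst (1/3) * 0"
    unfolding v jet_normal_form_def jet.case
    by (rule jet_eq_diff[OF antisym jet_eq_mult[OF jet_eq_refl *]])
  then show ?thesis
    by (simp add: jet_eq_sym)
qed

text \<open>The normal form sends an arbitrary jet to a symmetric one. Agreement on symmetric jets
  therefore makes the normal forms of \<open>p\<close> and \<open>q\<close> agree everywhere, hence
  be equal, and each polynomial is congruent to its normal form.\<close>

lemma jet_eq_iff_poly_eval_eq:
  "p \<approx>\<^sub>J q \<longleftrightarrow> (\<forall>J. jet_symmetric J \<longrightarrow> poly_eval J p = poly_eval J q)"
proof
  assume *: "\<forall>J. jet_symmetric J \<longrightarrow> poly_eval J p = poly_eval J q"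
  have "psubst jet_normal_form p - psubst jet_normal_form q = 0"
    using *[rule_format, OF jet_symmetric_normal_form]
    by (intro poly_eval_eq_0_imp_0) (simp add: poly_eval_diff poly_eval_psubst)
  moreover have "p \<approx>\<^sub>J psubst jet_normal_form p" for p :: "'a jet rpoly"
    using jet_eq_psubst[of pvar jet_normal_form p, OF jet_normal_form_eq] by (simp add: psubst_pvar)
  ultimately show "p \<approx>\<^sub>J q"
    by (metis eq_iff_diff_eq_0 jet_eq_sym jet_eq_trans)
qed (blast intro: jet_eq_imp_poly_eval_eq)

subsection \<open>The tensors E are the linearized curvatures\<close>

abbreviation slot_swap :: "nat \<Rightarrow> nat \<Rightarrow> nat \<Rightarrow> nat"
  where "slot_swap \<equiv> Transposition.transpose"

section \<open>Alternation over the columns of the tableau\<close>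

definition alternation :: "nat set \<Rightarrow> ((nat \<Rightarrow> 'n) \<Rightarrow> real) \<Rightarrow> (nat \<Rightarrow> 'n) \<Rightarrow> real"
  where "alternation S F i = (\<Sum>p | p permutes S. of_int (sign p) * F (i \<circ> p))"

lemma alternation_cmult: "alternation S (\<lambda>i. c * F i) i = c * alternation S F i"
  by (simp add: alternation_def sum_distrib_left mult_ac)

lemma alternation_sum: "alternation S (\<lambda>i. \<Sum>x\<in>A. F x i) = (\<lambda>i. \<Sum>x\<in>A. alternation S (F x) i)"
  by (rule ext) (simp add: alternation_def sum_distrib_left, rule sum.swap)

text \<open>Composition with the transposition pairs terms that have equal values and opposite
  signs.\<close>

lemma alternation_eq_0:
  assumes "finite S" "x \<in> S" "y \<in> S" "x \<noteq> y"
    and inv: "\<And>i. F (i \<circ> slot_swap x y) = F i"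
  shows "alternation S F i = 0"
proof -
  let ?\<tau> = "slot_swap x y"
  have "alternation S F i = (\<Sum>p | p permutes S. of_int (sign (p \<circ> ?\<tau>)) * F (i \<circ> (p \<circ> ?\<tau>)))"
    unfolding alternation_def
    by (rule sum.reindex_bij_witness[of _ "\<lambda>p. p \<circ> ?\<tau>" "\<lambda>p. p \<circ> ?\<tau>"])
      (use assms in \<open>auto simp: comp_assoc intro!: permutes_compose permutes_swap_id\<close>)
  also have "\<dots> = - alternation S F i"
    unfolding alternation_def sum_negf[symmetric]
  proof (rule sum.cong)
    fix p assume "p \<in> {p. p permutes S}"
    then have "sign (p \<circ> ?\<tau>) = - sign p"
      using assms by (simp add: sign_compose permutation_swap_id permutes_imp_permutation sign_swap_id)
    then show "of_int (sign (p \<circ> ?\<tau>)) * F (i \<circ> (p \<circ> ?\<tau>)) = - (of_int (sign p) * F (i \<circ> p))"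
      using inv[of "i \<circ> p"] by (simp add: comp_assoc)
  qed simp
  finally show ?thesis by simp
qed

lemma alternation_comp:
  assumes "\<And>p. p permutes S \<Longrightarrow> \<tau> \<circ> p = p \<circ> \<tau>" and "\<And>i. F (i \<circ> \<tau>) = F i"
  shows "alternation S F (i \<circ> \<tau>) = alternation S F i"
  unfolding alternation_def
proof (rule sum.cong)
  fix p assume "p \<in> {p. p permutes S}"
  then have "F (i \<circ> \<tau> \<circ> p) = F (i \<circ> p)"
    using assms(1)[of p] assms(2)[of "i \<circ> p"] by (simp add: comp_assoc)
  then show "of_int (sign p) * F (i \<circ> \<tau> \<circ> p) = of_int (sign p) * F (i \<circ> p)" by simp
qed simp

lemma alternation_pair:
  assumes "x \<noteq> y"
  shows "alternation {x, y} F i = F i - F (i \<circ> slot_swap x y)"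
  using assms unfolding alternation_def
  by (subst sum_over_permutations_insert) (simp_all add: sign_swap_id)

lemma alternation_triple:
  assumes "distinct [x, y, z]"
  shows "alternation {x, y, z} F i = F i - F (i \<circ> slot_swap x y) - F (i \<circ> slot_swap x z)
    - F (i \<circ> slot_swap y z) + F (i \<circ> (slot_swap x y \<circ> slot_swap y z)) + F (i \<circ> (slot_swap x z \<circ> slot_swap y z))"
  using assms unfolding alternation_def
  by (simp add: sum_over_permutations_insert sign_swap_id sign_compose permutation_swap_id permutation_compose)

definition column_alternation :: "nat \<Rightarrow> ((nat \<Rightarrow> 'n) \<Rightarrow> real) \<Rightarrow> (nat \<Rightarrow> 'n) \<Rightarrow> real"
  where "column_alternation k F = alternation {0, 1, k + 2} (alternation {2, k + 1} F)"

lemma slot_swap_commute: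
  "{x, y} \<inter> {u, v} = {} \<Longrightarrow> slot_swap x y \<circ> slot_swap u v = slot_swap u v \<circ> slot_swap x y"
  by (auto simp: fun_eq_iff Transposition.transpose_def)

text \<open>For the long column, the inner alternation runs over a disjoint column and so preserves
  the invariance; for the short column, the inner alternation already vanishes.\<close>

lemma column_alternation_eq_0:
  assumes k: "2 \<le> k"
    and xy: "x \<noteq> y" "{x, y} \<subseteq> {0, 1, k + 2} \<or> {x, y} \<subseteq> {2, k + 1}"
    and inv: "\<And>i. F (i \<circ> slot_swap x y) = F i"
  shows "column_alternation k F i = 0"
  using xy(2)
proof
  assume *: "{x, y} \<subseteq> {0, 1, k + 2}"
  have "slot_swap x y \<circ> p = p \<circ> slot_swap x y" if "p permutes {2, k + 1}" for p
  proof -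
    have "p = id \<or> p = slot_swap 2 (k + 1)"
      using that by (simp add: permutes_doubleton_iff)
    moreover have "{x, y} \<inter> {2, k + 1} = {}"
      using * k by auto
    ultimately show ?thesis
      using slot_swap_commute[of x y 2 "k + 1"] by auto
  qed
  then have "alternation {2, k + 1} F (i \<circ> slot_swap x y) = alternation {2, k + 1} F i" for i
    by (rule alternation_comp) (auto simp: inv)
  then show ?thesis
    unfolding column_alternation_def using * xy(1) by (intro alternation_eq_0) auto
next
  assume "{x, y} \<subseteq> {2, k + 1}"
  then have "alternation {2, k + 1} F i = 0" for i
    using xy(1) inv by (intro alternation_eq_0) auto
  then show ?thesis
    by (simp add: column_alternation_def alternation_def)
qed

text \<open>\<open>X\<close> is the alternation over the short column. The slots 3 to
  \<open>k\<close> lie in columns of one box, so their multiset passes through unchanged and six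
  terms remain.\<close>

lemma column_alternation_eq:
  fixes \<Phi> :: "'n \<Rightarrow> 'n \<Rightarrow> 'n \<Rightarrow> 'n \<Rightarrow> 'n \<Rightarrow> 'n multiset \<Rightarrow> real"
  assumes k: "2 \<le> k"
    and F: "\<And>i. F i = \<Phi> (i 0) (i 1) (i 2) (i (k + 1)) (i (k + 2)) (image_mset i (mset_set {3..k}))"
    and X: "\<And>a b e. X a b e = \<Phi> a b (i 2) (i (k + 1)) e (image_mset i (mset_set {3..k}))
      - \<Phi> a b (i (k + 1)) (i 2) e (image_mset i (mset_set {3..k}))"
  shows "column_alternation k F i =
    X (i 0) (i 1) (i (k + 2)) - X (i 1) (i 0) (i (k + 2)) - X (i (k + 2)) (i 1) (i 0)
    - X (i 0) (i (k + 2)) (i 1) + X (i 1) (i (k + 2)) (i 0) + X (i (k + 2)) (i 0) (i 1)"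
proof -
  have M: "image_mset (i \<circ> slot_swap x y) (mset_set {3..k}) = image_mset i (mset_set {3..k})"
    if "x \<notin> {3..k}" "y \<notin> {3..k}" for i :: "nat \<Rightarrow> 'n" and x y
    using that by (intro image_mset_cong) (auto simp: Transposition.transpose_def)
  have pair: "alternation {2, k + 1} F i = F i - F (i \<circ> slot_swap 2 (k + 1))" for i
    using k by (intro alternation_pair) auto
  have "distinct [0, 1, k + 2]"
    by simp
  note triple = alternation_triple[OF this]
  show ?thesis
    unfolding column_alternation_def triple pair F o_assoc
    using k by (simp add: M X Transposition.transpose_def)
qed

section \<open>Contribution of the row permutations\<close>

definition jet_slots :: "nat \<Rightarrow> ('n jet \<Rightarrow> real) \<Rightarrow> (nat \<Rightarrow> 'n) \<Rightarrow> real"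
  where "jet_slots k J i = J (Jet (i 0) (i 1) (i 2) (map i [3..<k+3]))"

text \<open>A row permutation \<open>p\<close> contributes only if no column has two slots filled from derivative
  indices; this leaves the identity and the exchange of \<open>a\<close> and \<open>c\<close>, up to permutations of
  the derivatives.\<close>

definition row_weight :: "(nat \<Rightarrow> nat) \<Rightarrow> (nat \<Rightarrow> nat) \<Rightarrow> real"
  where "row_weight p q = (if q = id then
     (if p 0 = 0 \<and> p 2 = 2 then 1 else if p 0 = 2 \<and> p 2 = 0 then 1/2 else 0) else 0)"

lemma jet_slots_array:
  assumes "jet_symmetric J"
  shows "jet_slots k J i = jet_array J (i 0) (i 1) (i 2) (image_mset i (mset_set {3..<k+3}))"
  unfolding jet_slots_def jet_array_mset[OF assms, symmetric] by (simp del: upt_Suc)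

lemma derivative_slots:
  assumes "2 \<le> (k::nat)"
  shows "image_mset i (mset_set {3..<k+3}) =
    add_mset (i (k + 2)) (add_mset (i (k + 1)) (image_mset i (mset_set {3..k})))"
proof -
  have "{3..<k+3} = insert (k + 1) (insert (k + 2) {3..k})"
    using assms by auto
  then show ?thesis by simp
qed

text \<open>Alternation over the long column produces each term of H twice, by antisymmetry of T in
  a, b. After exchange of a and c, the cyclic identity gives T_cba - T_cab = T_abc, so each term
  appears only once. This is the origin of the 1/2 in \<open>row_weight\<close>.\<close>

lemma column_alternation_jet_slots:
  assumes k: "2 \<le> k" and J: "jet_symmetric J"
  shows "column_alternation k (jet_slots k J) i =
      - 2 * curvature (jet_array J) (i (k + 2)) (i 0) (i 1) (i 2) (i (k + 1)) (image_mset i (mset_set {3..k}))"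
    and "column_alternation k (\<lambda>i. jet_slots k J (i \<circ> slot_swap 0 2)) i =
      - curvature (jet_array J) (i (k + 2)) (i 0) (i 1) (i 2) (i (k + 1)) (image_mset i (mset_set {3..k}))"
proof -
  let ?T = "jet_array J"
  have anti: "?T b a c M = - ?T a b c M" and cyc: "?T a b c M + ?T c a b M + ?T b c a M = 0" for a b c M
    using hook_symmetric_jet_array[OF J] unfolding hook_symmetric_def by blast+
  have sym: "?T c b a M = ?T a b c M + ?T c a b M" for a b c M
    using cyc[of a b c M] anti[of c b a M] by simp
  have t: "jet_slots k J i = ?T (i 0) (i 1) (i 2)
      (add_mset (i (k + 2)) (add_mset (i (k + 1)) (image_mset i (mset_set {3..k}))))" for i
    by (simp only: jet_slots_array[OF J] derivative_slots[OF k])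
  have swap: "image_mset (i \<circ> slot_swap 0 2) (mset_set {3..k}) = image_mset i (mset_set {3..k})" for i :: "nat \<Rightarrow> 'a"
    by (intro image_mset_cong) (auto simp: Transposition.transpose_def)
  have t': "jet_slots k J (i \<circ> slot_swap 0 2) = ?T (i 2) (i 1) (i 0)
      (add_mset (i (k + 2)) (add_mset (i (k + 1)) (image_mset i (mset_set {3..k}))))" for i
    unfolding t swap using k by (simp add: Transposition.transpose_def)
  show "column_alternation k (jet_slots k J) i =
      - 2 * curvature ?T (i (k + 2)) (i 0) (i 1) (i 2) (i (k + 1)) (image_mset i (mset_set {3..k}))"
    by (subst column_alternation_eq[where \<Phi> = "\<lambda>a b c f e M. ?T a b c (add_mset e (add_mset f M))"
        and X = "\<lambda>a b e. ?T a b (i 2) (add_mset e (add_mset (i (k + 1)) (image_mset i (mset_set {3..k}))))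
          - ?T a b (i (k + 1)) (add_mset e (add_mset (i 2) (image_mset i (mset_set {3..k}))))", OF k t refl])
      (simp add: curvature_def field_strength_def anti[of "i 0" "i 1", simplified] anti[of "i 0" "i (Suc (Suc k))"]
        anti[of "i 1" "i (Suc (Suc k))", simplified])
  show "column_alternation k (\<lambda>i. jet_slots k J (i \<circ> slot_swap 0 2)) i =
      - curvature ?T (i (k + 2)) (i 0) (i 1) (i 2) (i (k + 1)) (image_mset i (mset_set {3..k}))"
    by (subst column_alternation_eq[where \<Phi> = "\<lambda>a b c f e M. ?T c b a (add_mset e (add_mset f M))"
        and X = "\<lambda>a b e. ?T (i 2) b a (add_mset e (add_mset (i (k + 1)) (image_mset i (mset_set {3..k}))))
          - ?T (i (k + 1)) b a (add_mset e (add_mset (i 2) (image_mset i (mset_set {3..k}))))", OF k t' refl])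
      (simp add: curvature_def field_strength_def
        sym[of _ "i 1" "i 0", simplified] sym[of _ "i (Suc (Suc k))" "i 1", simplified] sym[of _ "i 0" "i (Suc (Suc k))"])
qed

lemma jet_slots_comp_permutation:
  assumes J: "jet_symmetric J" and r: "r permutes {3..<k+3}"
  shows "jet_slots k J (i \<circ> r) = jet_slots k J i"
proof -
  have "image_mset (i \<circ> r) (mset_set {3..<k+3}) = image_mset i (image_mset r (mset_set {3..<k+3}))"
    by (simp add: multiset.map_comp)
  also have "image_mset r (mset_set {3..<k+3}) = mset_set {3..<k+3}"
    using permutes_inj_on[OF r] permutes_image[OF r] by (simp add: image_mset_mset_set)
  finally have M: "image_mset (i \<circ> r) (mset_set {3..<k+3}) = image_mset i (mset_set {3..<k+3})" .
  have "r 0 = 0" "r 1 = 1" "r 2 = 2"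
    by (auto intro!: permutes_not_in[OF r])
  then show ?thesis
    unfolding jet_slots_array[OF J] M by simp
qed

lemma column_alternation_row_permutation:
  assumes k: "2 \<le> k" and J: "jet_symmetric J"
    and p: "p permutes {0, 2} \<union> {3..k}" and q: "q permutes {1, k + 1}"
  shows "column_alternation k (\<lambda>i. jet_slots k J (i \<circ> p \<circ> q)) i =
    row_weight p q * column_alternation k (jet_slots k J) i"
proof -
  have inj: "inj (p \<circ> q)"
    using permutes_inj[OF p] permutes_inj[OF q] by (rule inj_compose)
  have p_fix: "p 1 = 1" "p (k + 1) = k + 1" "p (k + 2) = k + 2"
    using k by (auto intro!: permutes_not_in[OF p])
  \<comment> \<open>The derivative slots \<open>u\<close>, \<open>v\<close> receive the indices of
    slots \<open>x\<close>, \<open>y\<close> of one column; exchanging these two indices merely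
    permutes derivatives.\<close>
  have vanish: "column_alternation k (\<lambda>i. jet_slots k J (i \<circ> p \<circ> q)) i = 0"
    if "p (q u) = x" "p (q v) = y" "u \<in> {3..<k+3}" "v \<in> {3..<k+3}" "x \<noteq> y"
      "{x, y} \<subseteq> {0, 1, k + 2} \<or> {x, y} \<subseteq> {2, k + 1}" for u v x y
  proof (rule column_alternation_eq_0[OF k that(5,6)])
    fix i :: "nat \<Rightarrow> 'a"
    have "slot_swap x y \<circ> (p \<circ> q) = (p \<circ> q) \<circ> slot_swap u v"
      using that(1,2) injD[OF inj] by (auto simp: fun_eq_iff Transposition.transpose_def)
    then have "i \<circ> slot_swap x y \<circ> p \<circ> q = (i \<circ> p \<circ> q) \<circ> slot_swap u v"
      by (metis comp_assoc)
    then show "jet_slots k J (i \<circ> slot_swap x y \<circ> p \<circ> q) = jet_slots k J (i \<circ> p \<circ> q)"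
      using jet_slots_comp_permutation[OF J permutes_swap_id[OF that(3,4)]] by simp
  qed
  consider (swap) "q = slot_swap 1 (k + 1)" "q \<noteq> id"
    | (a) u where "q = id" "u \<in> {3..k}" "p u = 0"
    | (c) u where "q = id" "u \<in> {3..k}" "p u = 2"
    | (id) "q = id" "p 0 = 0" "p 2 = 2"
    | (ac) "q = id" "p 0 = 2" "p 2 = 0"
  proof -
    \<comment> \<open>The cases depend on which slots receive the indices a and c: a derivative
      slot, or the slots 0 and 2 in one of two orders.\<close>
    have "0 \<in> p ` ({0, 2} \<union> {3..k})" "2 \<in> p ` ({0, 2} \<union> {3..k})"
      unfolding permutes_image[OF p] by simp_all
    then obtain u v where uv: "0 = p u" "u \<in> {0, 2} \<union> {3..k}" "2 = p v" "v \<in> {0, 2} \<union> {3..k}"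
      by (elim imageE)
    have "q = id \<or> q = slot_swap 1 (k + 1) \<and> q \<noteq> id"
      using q by (auto simp: permutes_doubleton_iff)
    then show ?thesis
    proof
      assume "q = id"
      have "u = 0 \<and> v = 2 \<or> u = 2 \<and> v = 0" if "u \<notin> {3..k}" "v \<notin> {3..k}"
        using uv that by auto
      then show ?thesis
        using that(2-5) \<open>q = id\<close> uv(1,3) by metis
    qed (use that(1) in blast)
  qed
  then show ?thesis
  proof cases
    case swap
    \<comment> \<open>The index of slot 1 now fills derivative slot \<open>k + 1\<close>, while that
      of slot \<open>k + 2\<close> stays in place; both belong to the long column.\<close>
    have "column_alternation k (\<lambda>i. jet_slots k J (i \<circ> p \<circ> q)) i = 0"
      using k p_fix by (intro vanish[of "k + 1" 1 "k + 2" "k + 2"]) (auto simp: swap(1))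
    then show ?thesis
      using swap by (simp add: row_weight_def)
  next
    case a
    have "column_alternation k (\<lambda>i. jet_slots k J (i \<circ> p \<circ> q)) i = 0"
      using k p_fix a by (intro vanish[of u 0 "k + 2" "k + 2"]) auto
    moreover have "p 0 \<noteq> 0" "p 2 \<noteq> 0"
      using a permutes_inj[OF p] by (auto dest: injD[of p _ u])
    ultimately show ?thesis
      by (simp add: row_weight_def)
  next
    case c
    have "column_alternation k (\<lambda>i. jet_slots k J (i \<circ> p \<circ> q)) i = 0"
      using k p_fix c by (intro vanish[of u 2 "k + 1" "k + 1"]) auto
    moreover have "p 0 \<noteq> 2" "p 2 \<noteq> 2"
      using c permutes_inj[OF p] by (auto dest: injD[of p _ u])
    ultimately show ?thesis
      by (simp add: row_weight_def)
  next
    case id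
    have "p permutes {3..k}"
      using p by (rule permutes_superset) (use id in auto)
    then have "p permutes {3..<k+3}"
      by (rule permutes_subset) auto
    then show ?thesis
      using id by (simp add: row_weight_def jet_slots_comp_permutation[OF J])
  next
    case ac
    have "slot_swap 0 2 \<circ> p permutes {0, 2} \<union> {3..k}"
      using p by (intro permutes_compose permutes_swap_id) auto
    then have "slot_swap 0 2 \<circ> p permutes {3..k}"
      by (rule permutes_superset) (use ac in auto)
    then have r: "slot_swap 0 2 \<circ> p permutes {3..<k+3}"
      by (rule permutes_subset) auto
    \<comment> \<open>\<open>p\<close> is the exchange of slots 0 and 2 up to a permutation of the
      derivatives, which the jet does not see.\<close>
    have "i \<circ> p \<circ> q = i \<circ> slot_swap 0 2 \<circ> (slot_swap 0 2 \<circ> p)" for i :: "nat \<Rightarrow> 'a"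
      using ac(1) by (simp add: fun_eq_iff)
    then have "(\<lambda>i. jet_slots k J (i \<circ> p \<circ> q)) = (\<lambda>i. jet_slots k J (i \<circ> slot_swap 0 2))"
      by (simp only: jet_slots_comp_permutation[OF J r])
    then show ?thesis
      using ac by (simp add: row_weight_def column_alternation_jet_slots[OF k J])
  qed
qed

lemma poly_eval_antisymmetrize:
  "poly_eval J (antisymmetrize S t i) = 1 / fact (card S) * alternation S (\<lambda>i. poly_eval J (t i)) i"
  by (simp add: antisymmetrize_def alternation_def poly_eval_mult poly_eval_sum)

lemma poly_eval_symmetrize:
  "poly_eval J (symmetrize S t i) = 1 / fact (card S) * (\<Sum>p | p permutes S. poly_eval J (t (i \<circ> p)))"
  by (simp add: symmetrize_def poly_eval_mult poly_eval_sum)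

text \<open>No cancellation can occur among the row permutations: all weights are nonnegative and
  the identity has weight 1, so their sum is at least 1. The constant depends on neither the jet nor
  the index values.\<close>

lemma poly_eval_E_slots:
  assumes k: "2 \<le> k"
  shows "\<exists>\<kappa>. \<kappa> \<noteq> 0 \<and> (\<forall>(J :: 'n jet \<Rightarrow> real) i. jet_symmetric J \<longrightarrow>
    poly_eval J (E_slots k i) = \<kappa> * column_alternation k (jet_slots k J) i)"
proof -
  let ?R = "{0, 2} \<union> {3..k}"
  define N :: real where "N = 1 / fact (card {0, 1, k + 2}) * (1 / fact (card {2, k + 1})) *
    (1 / fact (card ?R)) * (1 / fact (card {1, k + 1}))"
  define W where "W = (\<Sum>p | p permutes ?R. \<Sum>q | q permutes {1, k + 1}. row_weight p q)"
  have fin: "finite {p. p permutes ?R}" "finite {q. q permutes {1, k + 1}}"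
    by (intro finite_permutations; simp)+
  have "1 \<le> row_weight id id"
    by (simp add: row_weight_def)
  also have "\<dots> \<le> (\<Sum>q | q permutes {1, k + 1}. row_weight id q)"
    by (rule member_le_sum) (use fin in \<open>auto simp: row_weight_def permutes_id[unfolded id_def] id_def\<close>)
  also have "\<dots> \<le> W"
    unfolding W_def
    by (rule member_le_sum[of id _ "\<lambda>p. \<Sum>q | q permutes {1, k + 1}. row_weight p q"])
      (use fin in \<open>auto simp: row_weight_def permutes_id[unfolded id_def] id_def intro!: sum_nonneg\<close>)
  finally have "W \<noteq> 0" by simp
  have "poly_eval J (E_slots k i) = N * W * column_alternation k (jet_slots k J) i"
    if J: "jet_symmetric J" for J :: "'n jet \<Rightarrow> real" and i
  proof -
    have "poly_eval J (E_slots k i) = N * column_alternation k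
        (\<lambda>i. \<Sum>p | p permutes ?R. \<Sum>q | q permutes {1, k + 1}. jet_slots k J (i \<circ> p \<circ> q)) i"
      by (simp only: E_slots_def poly_eval_antisymmetrize poly_eval_symmetrize column_alternation_def
          alternation_cmult sum_distrib_left[symmetric] N_def mult.assoc jet_tensor_def poly_eval_pvar
          jet_slots_def)
    also have "\<dots> = N * (\<Sum>p | p permutes ?R. \<Sum>q | q permutes {1, k + 1}.
        column_alternation k (\<lambda>i. jet_slots k J (i \<circ> p \<circ> q)) i)"
      by (simp only: column_alternation_def alternation_sum)
    also have "\<dots> = N * (W * column_alternation k (jet_slots k J) i)"
      unfolding W_def sum_distrib_right
      by (intro arg_cong2[where f = "(*)"] refl sum.cong)
        (use column_alternation_row_permutation[OF k J] in auto)
    finally show ?thesis by simp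
  qed
  then show ?thesis
    using \<open>W \<noteq> 0\<close> by (intro exI[of _ "N * W"]) (simp add: N_def)
qed

text \<open>Since \<kappa> is nonzero and depends only on the number of derivatives, this serves
  both directions: E inherits the invariance of the curvature, and every curvature component is a
  multiple of some E.\<close>

lemma poly_eval_E_T:
  "\<exists>\<kappa>. \<kappa> \<noteq> 0 \<and> (\<forall>(J :: 'n jet \<Rightarrow> real) a b c f e ds. length ds = n \<longrightarrow> jet_symmetric J \<longrightarrow>
    poly_eval J (E_T a b c (ds @ [f, e])) = \<kappa> * curvature (jet_array J) e a b c f (mset ds))"
proof -
  obtain \<kappa> where \<kappa>: "\<kappa> \<noteq> 0" and E: "\<And>(J :: 'n jet \<Rightarrow> real) i. jet_symmetric J \<Longrightarrow>
    poly_eval J (E_slots (n + 2) i) = \<kappa> * column_alternation (n + 2) (jet_slots (n + 2) J) i"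
    using poly_eval_E_slots[of "n + 2"] by auto
  have "poly_eval J (E_T a b c (ds @ [f, e])) = \<kappa> * (- 2) * curvature (jet_array J) e a b c f (mset ds)"
    if "length ds = n" "jet_symmetric J" for J :: "'n jet \<Rightarrow> real" and a b c f e ds
  proof -
    let ?i = "\<lambda>j. (a # b # c # ds @ [f, e]) ! j"
    have "{3..n + 2} = {3..<n + 3}"
      by auto
    then have "image_mset ?i (mset_set {3..n + 2}) = mset (map ?i [3..<n + 3])"
      by (simp del: upt_Suc)
    also have "map ?i [3..<n + 3] = ds"
      using that(1) by (intro nth_equalityI) (auto simp: nth_append)
    finally have M: "image_mset ?i (mset_set {3..n + 2}) = mset ds" .
    have len: "length (ds @ [f, e]) = n + 2"
      using that(1) by simp
    have "?i 0 = a" "?i 1 = b" "?i 2 = c" "?i (n + 2 + 1) = f" "?i (n + 2 + 2) = e"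
      using that(1) by (simp_all add: nth_append)
    moreover have "2 \<le> n + 2" by simp
    ultimately show ?thesis
      unfolding E_T_def len E[OF that(2)] column_alternation_jet_slots(1)[OF \<open>2 \<le> n + 2\<close> that(2)] M
      by (simp only: mult.assoc)
  qed
  then show ?thesis
    using \<kappa> by (intro exI[of _ "\<kappa> * (- 2)"]) auto
qed

subsection \<open>Iterated partial derivatives\<close>

lemma partials_Nil [simp]: "partials [] g = g"
  by (simp add: partials_def)

lemma partials_Cons [simp]: "partials (d # ds) g = partial d (partials ds g)"
  by (simp add: partials_def)

lemma partials_append: "partials (xs @ ys) g = partials xs (partials ys g)"
  by (simp add: partials_def)

lemma smooth_fun_partials: "smooth_fun g \<Longrightarrow> smooth_fun (partials ds g)"
  by (simp add: smooth_fun_def flip: partials_append)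

lemma smooth_fun_partial: "smooth_fun g \<Longrightarrow> smooth_fun (partial d g)"
  using smooth_fun_partials[of g "[d]"] by simp

lemma smooth_fun_differentiable: "smooth_fun g \<Longrightarrow> g differentiable (at x)"
  unfolding smooth_fun_def by (metis partials_Nil)

lemma partial_lincomb:
  assumes "f differentiable (at x)" "g differentiable (at x)"
  shows "partial d (\<lambda>x. f x + r * g x) x = partial d f x + r * partial d g x"
proof -
  have "((\<lambda>x. f x + r * g x) has_derivative
      (\<lambda>h. frechet_derivative f (at x) h + r * frechet_derivative g (at x) h)) (at x)"
    using assms by (auto intro!: derivative_eq_intros simp: frechet_derivative_works)
  from frechet_derivative_at[OF this] show ?thesis
    unfolding partial_def by metis
qed

lemma partials_lincomb:
  assumes "smooth_fun f" "smooth_fun g"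
  shows "partials ds (\<lambda>x. f x + r * g x) = (\<lambda>x. partials ds f x + r * partials ds g x)"
proof (induction ds)
  case (Cons d ds)
  show ?case
    using smooth_fun_partials[OF assms(1), of ds] smooth_fun_partials[OF assms(2), of ds]
    by (auto simp: Cons partial_lincomb smooth_fun_differentiable)
qed simp

lemma smooth_fun_lincomb:
  assumes "smooth_fun f" "smooth_fun g"
  shows "smooth_fun (\<lambda>x. f x + r * g x)"
  unfolding smooth_fun_def partials_lincomb[OF assms]
  using assms unfolding smooth_fun_def by (auto intro!: derivative_intros)

section \<open>Symmetry of second derivatives\<close>

lemma has_derivative_along_axis:
  assumes "g differentiable (at (y + t *\<^sub>R axis d 1))"
  shows "((\<lambda>t. g (y + t *\<^sub>R axis d 1)) has_real_derivative partial d g (y + t *\<^sub>R axis d 1)) (at t)"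
proof -
  let ?D = "frechet_derivative g (at (y + t *\<^sub>R axis d 1))"
  have g: "(g has_derivative ?D) (at (y + t *\<^sub>R axis d 1))"
    using assms by (simp add: frechet_derivative_works)
  then have "linear ?D"
    by (rule has_derivative_linear)
  have "((\<lambda>t. y + t *\<^sub>R axis d 1) has_derivative (\<lambda>h. h *\<^sub>R axis d 1)) (at t)"
    by (auto intro!: derivative_eq_intros)
  from has_derivative_compose[OF this g] show ?thesis
    by (simp add: has_field_derivative_def partial_def linear_scale[OF \<open>linear ?D\<close>] mult.commute[of _ "?D _"])
qed

lemma second_difference:
  fixes g :: "real^'n::finite \<Rightarrow> real"
  assumes g: "smooth_fun g" and h: "0 < h"
  shows "\<exists>z. dist z x \<le> 2 * h \<and>
    g (x + h *\<^sub>R axis a 1 + h *\<^sub>R axis b 1) - g (x + h *\<^sub>R axis a 1) - g (x + h *\<^sub>R axis b 1) + g x =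
      h * (h * partial b (partial a g) z)"
proof -
  let ?u = "axis a 1 :: real^'n" and ?v = "axis b 1 :: real^'n"
  have diff: "g differentiable (at y)" "partial a g differentiable (at y)" for y
    using g by (auto intro: smooth_fun_differentiable smooth_fun_partial)
  define \<phi> where "\<phi> s = g (x + h *\<^sub>R ?v + s *\<^sub>R ?u) - g (x + s *\<^sub>R ?u)" for s
  have "(\<phi> has_real_derivative (partial a g (x + h *\<^sub>R ?v + s *\<^sub>R ?u) - partial a g (x + s *\<^sub>R ?u))) (at s)" for s
    unfolding \<phi>_def by (intro DERIV_diff has_derivative_along_axis diff)
  from MVT2[OF h this] obtain s where s: "0 < s" "s < h"
    "\<phi> h - \<phi> 0 = h * (partial a g (x + h *\<^sub>R ?v + s *\<^sub>R ?u) - partial a g (x + s *\<^sub>R ?u))"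
    by auto
  have "((\<lambda>t. partial a g (x + s *\<^sub>R ?u + t *\<^sub>R ?v)) has_real_derivative
      partial b (partial a g) (x + s *\<^sub>R ?u + t *\<^sub>R ?v)) (at t)" for t
    by (intro has_derivative_along_axis diff)
  from MVT2[OF h this] obtain t where t: "0 < t" "t < h"
    "partial a g (x + s *\<^sub>R ?u + h *\<^sub>R ?v) - partial a g (x + s *\<^sub>R ?u) =
      h * partial b (partial a g) (x + s *\<^sub>R ?u + t *\<^sub>R ?v)"
    by auto
  let ?z = "x + s *\<^sub>R ?u + t *\<^sub>R ?v"
  have "dist ?z x \<le> norm (s *\<^sub>R ?u) + norm (t *\<^sub>R ?v)"
    using norm_triangle_ineq[of "s *\<^sub>R ?u" "t *\<^sub>R ?v"] by (simp add: dist_norm add.assoc)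
  also have "\<dots> \<le> 2 * h"
    using s t by (simp add: norm_axis_1)
  finally have "dist ?z x \<le> 2 * h" .
  moreover have "g (x + h *\<^sub>R ?u + h *\<^sub>R ?v) - g (x + h *\<^sub>R ?u) - g (x + h *\<^sub>R ?v) + g x = \<phi> h - \<phi> 0"
    by (simp add: \<phi>_def add_ac)
  moreover have "\<phi> h - \<phi> 0 = h * (h * partial b (partial a g) ?z)"
    using s(3) t(3) by (simp add: add_ac)
  ultimately show ?thesis by metis
qed

text \<open>The second difference is symmetric in the two directions, and the mean value theorem,
  applied twice, equates it with either mixed derivative near \<open>x\<close>. Continuity of both
  derivatives at \<open>x\<close> then forces equality.\<close>

lemma partial_commute:
  assumes g: "smooth_fun g"
  shows "partial a (partial b g) = partial b (partial a g)"
proof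
  fix x
  let ?A = "partial a (partial b g)" and ?B = "partial b (partial a g)"
  have cont: "isCont ?A x" "isCont ?B x"
    using g by (auto intro!: differentiable_imp_continuous_within smooth_fun_differentiable smooth_fun_partial)
  have "\<bar>?A x - ?B x\<bar> \<le> e" if "0 < e" for e
  proof -
    obtain r where r: "0 < r" "\<And>y. dist y x < r \<Longrightarrow> dist (?A y) (?A x) < e / 2"
      using cont(1) \<open>0 < e\<close> unfolding continuous_at_eps_delta by (metis half_gt_zero)
    obtain r' where r': "0 < r'" "\<And>y. dist y x < r' \<Longrightarrow> dist (?B y) (?B x) < e / 2"
      using cont(2) \<open>0 < e\<close> unfolding continuous_at_eps_delta by (metis half_gt_zero)
    define h where "h = min r r' / 3"
    have h: "0 < h" "2 * h < r" "2 * h < r'"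
      using r(1) r'(1) by (auto simp: h_def)
    obtain z where z: "dist z x \<le> 2 * h"
      "g (x + h *\<^sub>R axis a 1 + h *\<^sub>R axis b 1) - g (x + h *\<^sub>R axis a 1) - g (x + h *\<^sub>R axis b 1) + g x = h * (h * ?B z)"
      using second_difference[OF g h(1), of x a b] by blast
    obtain y where y: "dist y x \<le> 2 * h"
      "g (x + h *\<^sub>R axis b 1 + h *\<^sub>R axis a 1) - g (x + h *\<^sub>R axis b 1) - g (x + h *\<^sub>R axis a 1) + g x = h * (h * ?A y)"
      using second_difference[OF g h(1), of x b a] by blast
    have "h * (h * ?A y) = h * (h * ?B z)"
      using y(2) z(2) unfolding add.assoc add.commute[of "h *\<^sub>R axis b 1" "h *\<^sub>R axis a 1"] by linarith
    then have "?A y = ?B z"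
      using h(1) by simp
    moreover have "dist (?A y) (?A x) < e / 2" "dist (?B z) (?B x) < e / 2"
      using r(2) r'(2) y(1) z(1) h by force+
    ultimately show ?thesis
      unfolding dist_real_def by linarith
  qed
  then have "\<bar>?A x - ?B x\<bar> \<le> 0"
    by (rule field_le_epsilon[of _ 0, simplified])
  then show "?A x = ?B x" by simp
qed

lemma partials_partial_commute:
  assumes "smooth_fun g"
  shows "partials ds (partial a g) = partial a (partials ds g)"
  by (induction ds) (simp_all add: partial_commute[OF smooth_fun_partials[OF assms]])

lemma partials_perm:
  assumes "smooth_fun g" "mset ds = mset ds'"
  shows "partials ds g = partials ds' g"
  using assms(2)
proof (induction ds arbitrary: ds')
  case (Cons a ds)
  then obtain xs ys where ds': "ds' = xs @ a # ys"
    by (metis list.set_intros(1) set_mset_mset split_list)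
  then have "partials ds g = partials (xs @ ys) g"
    using Cons.prems by (intro Cons.IH) simp
  then show ?case
    by (simp add: ds' partials_append partials_partial_commute[OF smooth_fun_partials[OF assms(1)]])
qed simp

subsection \<open>Jets of gauge variations\<close>

text \<open>A single array suffices: \<epsilon> drops out of s_ab - s_ba, which is 2 \<eta>_ab and
  thus reproduces the last term of the variation.\<close>

lemma partials_gauge_T:
  assumes \<epsilon>: "sym_param \<epsilon>" and \<eta>: "antisym_param \<eta>"
  shows "partials ds (gauge_T \<epsilon> \<eta> a b c) x =
    gauge_array (\<lambda>b c M. partials (list_of_mset M) (\<epsilon> b c) x + partials (list_of_mset M) (\<eta> b c) x) a b c (mset ds)"
proof -
  have smooth: "smooth_fun (\<epsilon> a b)" "smooth_fun (\<eta> a b)" for a b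
    using \<epsilon> \<eta> unfolding sym_param_def antisym_param_def by blast+
  have perm: "partials ds (partial a (\<epsilon> b c)) x = partials (list_of_mset (add_mset a (mset ds))) (\<epsilon> b c) x"
    "partials ds (partial a (\<eta> b c)) x = partials (list_of_mset (add_mset a (mset ds))) (\<eta> b c) x" for a b c
    using partials_append[of ds "[a]" "\<epsilon> b c"] partials_append[of ds "[a]" "\<eta> b c"]
      partials_perm[OF smooth(1), of "ds @ [a]" "list_of_mset (add_mset a (mset ds))" b c]
      partials_perm[OF smooth(2), of "ds @ [a]" "list_of_mset (add_mset a (mset ds))" b c] by simp_all
  have \<epsilon>_sym: "\<epsilon> b a = \<epsilon> a b"
    using \<epsilon> unfolding sym_param_def by blast
  have "\<eta> b a = - \<eta> a b"
    using \<eta> unfolding antisym_param_def by blast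
  then have "\<eta> b a = (\<lambda>x. \<eta> a b x + (- 2) * \<eta> a b x)"
    by auto
  then have \<eta>_anti: "partials ds (\<eta> b a) x = - partials ds (\<eta> a b) x" for ds
    by (simp only: partials_lincomb[OF smooth(2) smooth(2)])
  have "gauge_T \<epsilon> \<eta> a b c = (\<lambda>x. (((partial a (\<epsilon> b c) x + (- 1) * partial b (\<epsilon> a c) x) + 1 * partial a (\<eta> b c) x)
      + (- 1) * partial b (\<eta> a c) x) + (- 2) * partial c (\<eta> a b) x)"
    by (auto simp: gauge_T_def)
  then have "partials ds (gauge_T \<epsilon> \<eta> a b c) x = (((partials ds (partial a (\<epsilon> b c)) x
      + (- 1) * partials ds (partial b (\<epsilon> a c)) x) + 1 * partials ds (partial a (\<eta> b c)) x)
      + (- 1) * partials ds (partial b (\<eta> a c)) x) + (- 2) * partials ds (partial c (\<eta> a b)) x"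
    by (simp only: partials_lincomb smooth_fun_lincomb smooth_fun_partial smooth)
  then show ?thesis
    unfolding perm by (simp add: gauge_array_def \<epsilon>_sym \<eta>_anti)
qed

section \<open>Smooth functions with prescribed jets of finite order\<close>

text \<open>The homogeneous polynomial of degree \<open>j\<close> whose \<open>j\<close>-th derivatives are \<open>j!\<close> times \<open>s\<close>.\<close>

fun homogeneous :: "nat \<Rightarrow> ('n::finite multiset \<Rightarrow> real) \<Rightarrow> real^'n \<Rightarrow> real" where
  "homogeneous 0 s x = s {#}"
| "homogeneous (Suc j) s x = (\<Sum>d\<in>UNIV. x $ d * homogeneous j (\<lambda>M. s (add_mset d M)) x)"

definition taylor :: "nat \<Rightarrow> ('n::finite multiset \<Rightarrow> real) \<Rightarrow> real^'n \<Rightarrow> real"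
  where "taylor N s x = (\<Sum>j\<le>N. homogeneous j s x / fact j)"

lemma has_derivative_homogeneous:
  "(homogeneous j s has_derivative
      (\<lambda>h. \<Sum>a\<in>UNIV. h $ a * (real j * homogeneous (j - 1) (\<lambda>M. s (add_mset a M)) x))) (at x)"
proof (induction j arbitrary: s)
  case 0
  show ?case by simp
next
  case (Suc j)
  let ?s = "\<lambda>a M. s (add_mset a M)"
  \<comment> \<open>For \<open>j = 0\<close> both sides vanish; otherwise this is the recursion for
    \<open>homogeneous\<close> read backwards.\<close>
  have euler: "(\<Sum>d\<in>UNIV. x $ d * (real j * homogeneous (j - 1) (\<lambda>M. s (add_mset a (add_mset d M))) x)) =
      real j * homogeneous j (?s a) x" for a
    by (cases j) (simp_all add: sum_distrib_left mult_ac)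
  have nth: "((\<lambda>x. x $ d) has_derivative (\<lambda>h. h $ d)) (at x)" for d
    by (rule bounded_linear_imp_has_derivative[OF bounded_linear_vec_nth])
  have "((\<lambda>x. \<Sum>d\<in>UNIV. x $ d * homogeneous j (?s d) x) has_derivative
      (\<lambda>h. \<Sum>d\<in>UNIV. x $ d * (\<Sum>a\<in>UNIV. h $ a * (real j * homogeneous (j - 1) (\<lambda>M. s (add_mset d (add_mset a M))) x))
        + h $ d * homogeneous j (?s d) x)) (at x)"
    by (intro has_derivative_sum has_derivative_mult nth Suc.IH)
  also have "(\<lambda>h. \<Sum>d\<in>UNIV. x $ d * (\<Sum>a\<in>UNIV. h $ a * (real j * homogeneous (j - 1) (\<lambda>M. s (add_mset d (add_mset a M))) x))
        + h $ d * homogeneous j (?s d) x) =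
      (\<lambda>h. \<Sum>a\<in>UNIV. h $ a * (real (Suc j) * homogeneous (Suc j - 1) (?s a) x))"
  proof
    fix h
    have "(\<Sum>d\<in>UNIV. x $ d * (\<Sum>a\<in>UNIV. h $ a * (real j * homogeneous (j - 1) (\<lambda>M. s (add_mset d (add_mset a M))) x))) =
        (\<Sum>a\<in>UNIV. h $ a * (\<Sum>d\<in>UNIV. x $ d * (real j * homogeneous (j - 1) (\<lambda>M. s (add_mset a (add_mset d M))) x)))"
      unfolding sum_distrib_left by (subst sum.swap) (simp add: mult_ac add_mset_commute)
    then show "(\<Sum>d\<in>UNIV. x $ d * (\<Sum>a\<in>UNIV. h $ a * (real j * homogeneous (j - 1) (\<lambda>M. s (add_mset d (add_mset a M))) x))
        + h $ d * homogeneous j (?s d) x) =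
      (\<Sum>a\<in>UNIV. h $ a * (real (Suc j) * homogeneous (Suc j - 1) (?s a) x))"
      by (simp add: euler[unfolded One_nat_def] sum.distrib distrib_left distrib_right add.commute)
  qed
  finally show ?case by simp
qed

lemma partial_homogeneous:
  "partial a (homogeneous j s) x = real j * homogeneous (j - 1) (\<lambda>M. s (add_mset a M)) x"
proof -
  have "partial a (homogeneous j s) x =
      (\<Sum>b\<in>UNIV. axis a 1 $ b * (real j * homogeneous (j - 1) (\<lambda>M. s (add_mset b M)) x))"
    unfolding partial_def frechet_derivative_at[OF has_derivative_homogeneous, symmetric] ..
  also have "\<dots> = (\<Sum>b\<in>UNIV. if b = a then real j * homogeneous (j - 1) (\<lambda>M. s (add_mset a M)) x else 0)"
    by (intro sum.cong) (auto simp: axis_def)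
  finally show ?thesis by simp
qed

lemma taylor_0: "taylor 0 s = (\<lambda>_. s {#})"
  by (simp add: taylor_def fun_eq_iff)

lemma taylor_Suc: "taylor (Suc N) s = (\<lambda>x. taylor N s x + 1 / fact (Suc N) * homogeneous (Suc N) s x)"
  by (simp add: taylor_def fun_eq_iff)

lemma differentiable_homogeneous: "homogeneous j s differentiable (at x)"
  using has_derivative_homogeneous unfolding differentiable_def by blast

lemma differentiable_taylor: "taylor N s differentiable (at x)"
  by (induction N)
    (auto simp: taylor_0 taylor_Suc simp del: fact_Suc homogeneous.simps
      intro!: derivative_intros differentiable_homogeneous)

lemma partial_taylor_0: "partial a (taylor 0 s) = taylor 0 (\<lambda>_. 0)"
  by (simp add: taylor_0 partial_def fun_eq_iff frechet_derivative_const)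

lemma partial_taylor_Suc: "partial a (taylor (Suc N) s) = taylor N (\<lambda>M. s (add_mset a M))"
proof (induction N)
  case 0
  have "partial a (taylor (Suc 0) s) x = partial a (taylor 0 s) x + 1 / fact (Suc 0) * partial a (homogeneous (Suc 0) s) x" for x
    unfolding taylor_Suc by (rule partial_lincomb) (rule differentiable_taylor differentiable_homogeneous)+
  then show ?case
    by (simp add: partial_taylor_0 partial_homogeneous fun_eq_iff del: homogeneous.simps(2)) (simp add: taylor_0)
next
  case (Suc N)
  have "partial a (taylor (Suc (Suc N)) s) x = partial a (taylor (Suc N) s) x
      + 1 / fact (Suc (Suc N)) * partial a (homogeneous (Suc (Suc N)) s) x" for x
    unfolding taylor_Suc[of "Suc N"]
    by (rule partial_lincomb) (rule differentiable_taylor differentiable_homogeneous)+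
  moreover have "1 / fact (Suc (Suc N)) * (real (Suc (Suc N)) * y) = 1 / fact (Suc N) * y" for y :: real
    by (simp only: fact_Suc of_nat_mult) simp
  ultimately show ?case
    unfolding Suc.IH partial_homogeneous diff_Suc_1 by (simp only: taylor_Suc)
qed

text \<open>Partial derivatives of Taylor polynomials are again of this form; the constant case
  stays inside the family as \<open>taylor 0\<close> of the zero array.\<close>

lemma smooth_fun_taylor: "smooth_fun (taylor N s)"
proof -
  have "\<exists>N' s'. partials ds (taylor N s) = taylor N' s'" for ds
  proof (induction ds)
    case (Cons d ds)
    then obtain N' s' where "partials ds (taylor N s) = taylor N' s'" by blast
    then show ?case
      by (cases N') (auto simp: partial_taylor_0 partial_taylor_Suc)
  qed auto
  then show ?thesis
    unfolding smooth_fun_def by (metis differentiable_taylor)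
qed

lemma partials_taylor:
  "length ds \<le> N \<Longrightarrow> partials ds (taylor N s) = taylor (N - length ds) (\<lambda>M. s (mset ds + M))"
proof (induction ds)
  case (Cons d ds)
  then have "N - length ds = Suc (N - length (d # ds))" by simp
  then show ?case
    using Cons by (simp add: partial_taylor_Suc del: length_Cons)
qed simp

lemma partials_taylor_at_0:
  assumes "length ds \<le> N"
  shows "partials ds (taylor N s) 0 = s (mset ds)"
proof -
  have "taylor N' s' 0 = s' {#}" for N' and s' :: "'a multiset \<Rightarrow> real"
    by (induction N') (simp_all add: taylor_0 taylor_Suc)
  then show ?thesis
    by (simp add: partials_taylor[OF assms])
qed

lemma homogeneous_uminus: "homogeneous j (\<lambda>M. - s M) x = - homogeneous j s x"
  by (induction j arbitrary: s) (simp_all add: sum_negf)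

text \<open>Every array \<open>s\<close> is, up to a given order, the jet of actual smooth
  parameters: \<epsilon> and \<eta> are the symmetric and antisymmetric parts of its Taylor
  polynomial.\<close>

lemma exists_gauge_params:
  fixes s :: "'n::finite \<Rightarrow> 'n \<Rightarrow> 'n multiset \<Rightarrow> real"
  shows "\<exists>\<epsilon> \<eta>. sym_param \<epsilon> \<and> antisym_param \<eta> \<and>
    (\<forall>a b c ds. length ds \<le> N \<longrightarrow> partials ds (gauge_T \<epsilon> \<eta> a b c) 0 = gauge_array s a b c (mset ds))"
proof -
  \<comment> \<open>Degree \<open>Suc N\<close>, as \<open>gauge_T\<close> contains one derivative
    of the parameters.\<close>
  define \<epsilon> where "\<epsilon> b c = taylor (Suc N) (\<lambda>M. (s b c M + s c b M) / 2)" for b c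
  define \<eta> where "\<eta> b c = taylor (Suc N) (\<lambda>M. (s b c M - s c b M) / 2)" for b c
  have \<epsilon>: "sym_param \<epsilon>"
    unfolding sym_param_def \<epsilon>_def by (simp add: smooth_fun_taylor add.commute)
  have "taylor (Suc N) (\<lambda>M. (s b c M - s c b M) / 2) = - taylor (Suc N) (\<lambda>M. (s c b M - s b c M) / 2)" for b c
  proof
    fix x :: "real^'n"
    have "(\<lambda>M. (s b c M - s c b M) / 2) = (\<lambda>M. - ((s c b M - s b c M) / 2))"
      by (rule ext) (simp add: field_simps)
    then show "taylor (Suc N) (\<lambda>M. (s b c M - s c b M) / 2) x = (- taylor (Suc N) (\<lambda>M. (s c b M - s b c M) / 2)) x"
      by (simp only: taylor_def homogeneous_uminus fun_Compl_def minus_divide_left[symmetric] sum_negf)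
  qed
  then have \<eta>: "antisym_param \<eta>"
    unfolding antisym_param_def \<eta>_def using smooth_fun_taylor by blast
  have "length (list_of_mset M) = size M" for M :: "'n multiset"
    by (metis mset_list_of_mset size_mset)
  then have "partials (list_of_mset M) (\<epsilon> b c) 0 + partials (list_of_mset M) (\<eta> b c) 0 = s b c M"
    if "size M \<le> Suc N" for b c M
    using that by (simp add: \<epsilon>_def \<eta>_def partials_taylor_at_0 field_simps)
  then have "partials ds (gauge_T \<epsilon> \<eta> a b c) 0 = gauge_array s a b c (mset ds)" if "length ds \<le> N" for a b c ds
    using that by (simp add: partials_gauge_T[OF \<epsilon> \<eta>] gauge_array_def)
  with \<epsilon> \<eta> show ?thesis by blast
qed

subsection \<open>Strict gauge invariance\<close>

definition gauge_jet ::
  "('n::finite \<Rightarrow> 'n \<Rightarrow> real^'n \<Rightarrow> real) \<Rightarrow> ('n \<Rightarrow> 'n \<Rightarrow> real^'n \<Rightarrow> real) \<Rightarrow> real^'n \<Rightarrow> 'n jet \<Rightarrow> real"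
  where "gauge_jet \<epsilon> \<eta> x v = partials (jderivs v) (gauge_T \<epsilon> \<eta> (jidx1 v) (jidx2 v) (jidx3 v)) x"

lemma gauge_jet_eq_gauge_array:
  assumes "sym_param \<epsilon>" "antisym_param \<eta>"
  shows "\<exists>s. \<forall>a b c ds. gauge_jet \<epsilon> \<eta> x (Jet a b c ds) = gauge_array s a b c (mset ds)"
  unfolding gauge_jet_def jet.sel partials_gauge_T[OF assms] by blast

lemma jet_symmetric_gauge_jet:
  assumes "sym_param \<epsilon>" "antisym_param \<eta>"
  shows "jet_symmetric (gauge_jet \<epsilon> \<eta> x)"
proof -
  obtain s where "\<And>a b c ds. gauge_jet \<epsilon> \<eta> x (Jet a b c ds) = gauge_array s a b c (mset ds)"
    using gauge_jet_eq_gauge_array[OF assms] by blast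
  then show ?thesis
    by (auto simp: jet_symmetric_def gauge_array_def)
qed

text \<open>From infinitesimal to finite: the gauge jet does not depend on \<open>J\<close>, so the
  flow is a translation, which stays within symmetric jets. The derivative along it is the gauge
  variation, so it vanishes at all \<open>t\<close> or, conversely, is read off at
  \<open>t = 0\<close>.\<close>

lemma strictly_gauge_invariant_iff:
  fixes f :: "'n::finite jet rpoly"
  shows "strictly_gauge_invariant f \<longleftrightarrow>
    (\<forall>\<epsilon> \<eta> x J t. sym_param \<epsilon> \<longrightarrow> antisym_param \<eta> \<longrightarrow> jet_symmetric J \<longrightarrow>
      poly_eval (\<lambda>v. J v + t * gauge_jet \<epsilon> \<eta> x v) f = poly_eval J f)"
proof -
  have der: "((\<lambda>t. poly_eval (\<lambda>v. J v + t * gauge_jet \<epsilon> \<eta> x v) f) has_real_derivative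
      poly_eval (\<lambda>v. J v + t * gauge_jet \<epsilon> \<eta> x v) (gauge_variation \<epsilon> \<eta> x f)) (at t)"
    for \<epsilon> \<eta> :: "'n \<Rightarrow> 'n \<Rightarrow> real^'n \<Rightarrow> real" and x J t
    using has_derivative_poly_eval[of J "gauge_jet \<epsilon> \<eta> x" f t]
    by (simp add: gauge_variation_def gauge_jet_def)
  show ?thesis
  proof (intro iffI allI impI)
    fix \<epsilon> \<eta> :: "'n \<Rightarrow> 'n \<Rightarrow> real^'n \<Rightarrow> real" and x t and J :: "'n jet \<Rightarrow> real"
    assume f: "strictly_gauge_invariant f" and \<epsilon>\<eta>: "sym_param \<epsilon>" "antisym_param \<eta>" and J: "jet_symmetric J"
    have "gauge_variation \<epsilon> \<eta> x f \<approx>\<^sub>J 0"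
      using f \<epsilon>\<eta> unfolding strictly_gauge_invariant_def by blast
    then have "poly_eval (\<lambda>v. J v + t * gauge_jet \<epsilon> \<eta> x v) (gauge_variation \<epsilon> \<eta> x f) = 0" for t
      using jet_eq_imp_poly_eval_eq[OF _ jet_symmetric_add_scaled[OF J jet_symmetric_gauge_jet[OF \<epsilon>\<eta>]]]
      by (simp only: poly_eval_0)
    with der[of J \<epsilon> \<eta> x] have
      "((\<lambda>t. poly_eval (\<lambda>v. J v + t * gauge_jet \<epsilon> \<eta> x v) f) has_real_derivative 0) (at t)" for t
      by simp
    then have "poly_eval (\<lambda>v. J v + t * gauge_jet \<epsilon> \<eta> x v) f = poly_eval (\<lambda>v. J v + 0 * gauge_jet \<epsilon> \<eta> x v) f"
      by (intro DERIV_isconst_all allI)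
    then show "poly_eval (\<lambda>v. J v + t * gauge_jet \<epsilon> \<eta> x v) f = poly_eval J f" by simp
  next
    assume const: "\<forall>\<epsilon> \<eta> x J t. sym_param \<epsilon> \<longrightarrow> antisym_param \<eta> \<longrightarrow> jet_symmetric J \<longrightarrow>
      poly_eval (\<lambda>v. J v + t * gauge_jet \<epsilon> \<eta> x v) f = poly_eval J f"
    have "poly_eval J (gauge_variation \<epsilon> \<eta> x f) = 0"
      if "sym_param \<epsilon>" "antisym_param \<eta>" "jet_symmetric J"
      for \<epsilon> \<eta> :: "'n \<Rightarrow> 'n \<Rightarrow> real^'n \<Rightarrow> real" and x J
    proof -
      have "((\<lambda>t. poly_eval J f) has_real_derivative poly_eval J (gauge_variation \<epsilon> \<eta> x f)) (at 0)"
        using der[of J \<epsilon> \<eta> x 0] const that by simp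
      then show ?thesis
        using DERIV_unique DERIV_const by blast
    qed
    then show "strictly_gauge_invariant f"
      by (simp add: strictly_gauge_invariant_def jet_eq_iff_poly_eval_eq)
  qed
qed

lemma strictly_gauge_invariant_cong:
  assumes "f \<approx>\<^sub>J g" "strictly_gauge_invariant f"
  shows "strictly_gauge_invariant g"
  using assms(2) jet_eq_imp_poly_eval_eq[OF assms(1)]
    jet_eq_imp_poly_eval_eq[OF assms(1) jet_symmetric_add_scaled[OF _ jet_symmetric_gauge_jet]]
  unfolding strictly_gauge_invariant_iff by metis

section \<open>Polynomials in E are invariant\<close>

abbreviation E_var :: "'n jet \<Rightarrow> 'n jet rpoly"
  where "E_var v \<equiv> E_T (jidx1 v) (jidx2 v) (jidx3 v) (jderivs v)"

lemma curvature_add_scaled: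
  "curvature (\<lambda>a b c M. T a b c M + t * T' a b c M) e a b c f M =
     curvature T e a b c f M + t * curvature T' e a b c f M"
  by (simp add: curvature_def field_strength_def algebra_simps)

lemma polynomial_in_E_imp_invariant:
  assumes "polynomial_in_E f"
  shows "strictly_gauge_invariant f"
proof -
  obtain g where g: "\<And>v. v \<in> pvars g \<Longrightarrow> 2 \<le> jet_order v" and f: "f \<approx>\<^sub>J psubst E_var g"
    using assms unfolding polynomial_in_E_def by blast
  have "poly_eval (\<lambda>v. J v + t * gauge_jet \<epsilon> \<eta> x v) (psubst E_var g) = poly_eval J (psubst E_var g)"
    if \<epsilon>\<eta>: "sym_param \<epsilon>" "antisym_param \<eta>" and J: "jet_symmetric J" for \<epsilon> \<eta> x J t
    unfolding poly_eval_psubst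
  proof (rule poly_eval_cong)
    fix v assume "v \<in> pvars g"
    then have "2 \<le> length (jderivs v)"
      using g by (simp add: jet_order_def)
    then obtain xs e where "jderivs v = xs @ [e]" "xs \<noteq> []"
      by (cases "jderivs v" rule: rev_cases) (auto simp: Suc_le_eq)
    then obtain ds d where ds: "jderivs v = ds @ [d, e]"
      by (cases xs rule: rev_cases) auto
    obtain \<kappa> where \<kappa>: "\<And>(J :: 'a jet \<Rightarrow> real) a b c f e ds'. length ds' = length ds \<Longrightarrow> jet_symmetric J \<Longrightarrow>
        poly_eval J (E_T a b c (ds' @ [f, e])) = \<kappa> * curvature (jet_array J) e a b c f (mset ds')"
      using poly_eval_E_T[of "length ds"] by metis
    obtain s where s: "\<And>a b c ds. gauge_jet \<epsilon> \<eta> x (Jet a b c ds) = gauge_array s a b c (mset ds)"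
      using gauge_jet_eq_gauge_array[OF \<epsilon>\<eta>] by blast
    have "jet_array (\<lambda>v. J v + t * gauge_jet \<epsilon> \<eta> x v) =
        (\<lambda>a b c M. jet_array J a b c M + t * gauge_array s a b c M)"
      by (simp add: jet_array_def s fun_eq_iff)
    then show "poly_eval (\<lambda>v. J v + t * gauge_jet \<epsilon> \<eta> x v) (E_var v) = poly_eval J (E_var v)"
      unfolding ds
      by (simp add: \<kappa> J jet_symmetric_add_scaled[OF J jet_symmetric_gauge_jet[OF \<epsilon>\<eta>]]
          curvature_add_scaled curvature_gauge_array)
  qed
  then have "strictly_gauge_invariant (psubst E_var g)"
    by (simp add: strictly_gauge_invariant_iff)
  then show ?thesis
    using f strictly_gauge_invariant_cong jet_eq_sym by blast
qed

section \<open>Invariants are polynomials in E\<close>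

definition residue_jet :: "('n jet \<Rightarrow> real) \<Rightarrow> 'n jet \<Rightarrow> real"
  where "residue_jet J v = hook_residue (jet_array J) (jidx1 v) (jidx2 v) (jidx3 v) (mset (jderivs v))"

text \<open>Translating by the negative of the gauge jet from \<open>gauge_fixing\<close> leaves
  \<open>f\<close> unchanged. It reaches the residue only up to order \<open>N\<close>, but
  \<open>f\<close> contains no variable beyond that.\<close>

lemma poly_eval_residue_jet:
  assumes f: "strictly_gauge_invariant f" and J: "jet_symmetric J"
  shows "poly_eval J f = poly_eval (residue_jet J) f"
proof -
  obtain s where s: "\<And>a b c M. jet_array J a b c M =
      gauge_array s a b c M + hook_residue (jet_array J) a b c M"
    using gauge_fixing[OF hook_symmetric_jet_array[OF J]] by blast
  define N where "N = Max (insert 0 (jet_order ` pvars f))"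
  obtain \<epsilon> \<eta> where \<epsilon>\<eta>: "sym_param \<epsilon>" "antisym_param \<eta>" and
    N: "\<And>a b c ds. length ds \<le> N \<Longrightarrow> partials ds (gauge_T \<epsilon> \<eta> a b c) 0 = gauge_array s a b c (mset ds)"
    using exists_gauge_params[of N s] by blast
  have "poly_eval J f = poly_eval (\<lambda>v. J v + (- 1) * gauge_jet \<epsilon> \<eta> 0 v) f"
    using f \<epsilon>\<eta> J unfolding strictly_gauge_invariant_iff by metis
  also have "\<dots> = poly_eval (residue_jet J) f"
  proof (rule poly_eval_cong)
    fix v assume "v \<in> pvars f"
    then have "length (jderivs v) \<le> N"
      unfolding N_def jet_order_def[symmetric] by (intro Max_ge) (auto simp: finite_pvars)
    then have "gauge_jet \<epsilon> \<eta> 0 v = gauge_array s (jidx1 v) (jidx2 v) (jidx3 v) (mset (jderivs v))"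
      by (simp add: gauge_jet_def N)
    moreover have "J v = jet_array J (jidx1 v) (jidx2 v) (jidx3 v) (mset (jderivs v))"
      by (simp add: jet_array_mset[OF J])
    ultimately show "J v + (- 1) * gauge_jet \<epsilon> \<eta> 0 v = residue_jet J v"
      using s by (simp add: residue_jet_def)
  qed
  finally show ?thesis .
qed

text \<open>Two contractions use up two derivative indices. This is where the order two of the
  theorem comes from.\<close>

lemma residue_jet_order_less_2:
  assumes "jet_order v < 2"
  shows "residue_jet J v = 0"
proof -
  have "curvature_contr T a b c M = 0" if "size M < 2" for T :: "'a hook_array" and a b c M
  proof -
    have "M = {#} \<or> (\<exists>d. M = {#d#})"
      using that by (metis less_2_cases size_1_singleton_mset One_nat_def size_eq_0_iff_empty)
    then show ?thesis
      by (auto simp: curvature_contr_def contr_add_mset)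
  qed
  then show ?thesis
    using assms by (simp add: residue_jet_def hook_residue_def jet_order_def)
qed

text \<open>Phrased for functions of the jet, so that membership can follow the formula for the
  residue through its sums, quotients and contractions.\<close>

definition E_expressible :: "(('n jet \<Rightarrow> real) \<Rightarrow> real) \<Rightarrow> bool"
  where "E_expressible F \<longleftrightarrow> (\<exists>g. (\<forall>v\<in>pvars g. 2 \<le> jet_order v) \<and>
    (\<forall>J. jet_symmetric J \<longrightarrow> F J = poly_eval J (psubst E_var g)))"

lemma E_expressible_const: "E_expressible (\<lambda>_. r)"
  unfolding E_expressible_def by (rule exI[of _ "pconst r"]) (simp add: poly_eval_psubst)

lemma E_expressible_add:
  assumes "E_expressible F" "E_expressible G"
  shows "E_expressible (\<lambda>J. F J + G J)"
proof -
  obtain f g where "\<forall>v\<in>pvars f. 2 \<le> jet_order v" "\<forall>v\<in>pvars g. 2 \<le> jet_order v"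
    "\<forall>J. jet_symmetric J \<longrightarrow> F J = poly_eval J (psubst E_var f)"
    "\<forall>J. jet_symmetric J \<longrightarrow> G J = poly_eval J (psubst E_var g)"
    using assms unfolding E_expressible_def by blast
  then show ?thesis
    using pvars_add[of f g] unfolding E_expressible_def
    by (intro exI[of _ "f + g"]) (auto simp: poly_eval_psubst poly_eval_add)
qed

lemma E_expressible_mult:
  assumes "E_expressible F" "E_expressible G"
  shows "E_expressible (\<lambda>J. F J * G J)"
proof -
  obtain f g where "\<forall>v\<in>pvars f. 2 \<le> jet_order v" "\<forall>v\<in>pvars g. 2 \<le> jet_order v"
    "\<forall>J. jet_symmetric J \<longrightarrow> F J = poly_eval J (psubst E_var f)"
    "\<forall>J. jet_symmetric J \<longrightarrow> G J = poly_eval J (psubst E_var g)"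
    using assms unfolding E_expressible_def by blast
  then show ?thesis
    using pvars_mult[of f g] unfolding E_expressible_def
    by (intro exI[of _ "f * g"]) (auto simp: poly_eval_psubst poly_eval_mult)
qed

lemma E_expressible_diff: "E_expressible F \<Longrightarrow> E_expressible G \<Longrightarrow> E_expressible (\<lambda>J. F J - G J)"
  using E_expressible_add[of F "\<lambda>J. (- 1) * G J"] E_expressible_mult[OF E_expressible_const[of "- 1"], of G]
  by simp

lemma E_expressible_divide: "E_expressible F \<Longrightarrow> E_expressible (\<lambda>J. F J / r)"
  using E_expressible_mult[OF _ E_expressible_const[of "inverse r"], of F] by (simp add: divide_inverse)

lemma E_expressible_contr:
  assumes "\<And>a K. E_expressible (\<lambda>J. A J a K)"
  shows "E_expressible (\<lambda>J. contr (A J) M)"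
proof -
  have "E_expressible (\<lambda>J. \<Sum>a\<in>#K. A J a (M - {#a#}))" for K
    by (induction K) (simp_all add: E_expressible_const E_expressible_add assms)
  then show ?thesis
    by (simp add: contr_def)
qed

lemma E_expressible_curvature: "E_expressible (\<lambda>J. curvature (jet_array J) e a b c f M)"
proof -
  obtain \<kappa> where \<kappa>: "\<kappa> \<noteq> 0" "\<And>J :: 'a jet \<Rightarrow> real. jet_symmetric J \<Longrightarrow>
      poly_eval J (E_T a b c (list_of_mset M @ [f, e])) = \<kappa> * curvature (jet_array J) e a b c f M"
    using poly_eval_E_T[of "length (list_of_mset M)"] by (metis mset_list_of_mset)
  let ?v = "Jet a b c (list_of_mset M @ [f, e])"
  have "\<forall>v\<in>pvars (pconst (1 / \<kappa>) * pvar ?v). 2 \<le> jet_order v"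
    using pvars_mult[of "pconst (1 / \<kappa>)" "pvar ?v"] by (auto simp: jet_order_def)
  then show ?thesis
    unfolding E_expressible_def using \<kappa>
    by (intro exI[of _ "pconst (1 / \<kappa>) * pvar ?v"]) (simp add: poly_eval_psubst poly_eval_mult)
qed

lemma E_expressible_residue_jet: "E_expressible (\<lambda>J. residue_jet J v)"
  unfolding residue_jet_def hook_residue_def curvature_contr_def
  by (intro E_expressible_divide E_expressible_diff E_expressible_add E_expressible_contr E_expressible_curvature)

text \<open>An invariant takes the same value on a jet and on its residue, so it suffices to
  substitute for each variable the expression of its residue in E.\<close>

lemma invariant_imp_polynomial_in_E:
  assumes f: "strictly_gauge_invariant f"
  shows "polynomial_in_E f"
proof -
  have "\<exists>h :: 'a jet \<Rightarrow> 'a jet rpoly. \<forall>v. (\<forall>u\<in>pvars (h v). 2 \<le> jet_order u) \<and>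
      (\<forall>J. jet_symmetric J \<longrightarrow> residue_jet J v = poly_eval J (psubst E_var (h v)))"
    using E_expressible_residue_jet unfolding E_expressible_def by (intro choice) blast
  then obtain h :: "'a jet \<Rightarrow> 'a jet rpoly" where h: "\<And>v u. u \<in> pvars (h v) \<Longrightarrow> 2 \<le> jet_order u"
    "\<And>v J. jet_symmetric J \<Longrightarrow> residue_jet J v = poly_eval J (psubst E_var (h v))"
    by blast
  have "poly_eval J f = poly_eval J (psubst E_var (psubst h f))" if "jet_symmetric J" for J
  proof -
    have "residue_jet J = (\<lambda>v. poly_eval J (psubst E_var (h v)))"
      using h(2)[OF that] by auto
    then show ?thesis
      by (simp add: poly_eval_residue_jet[OF f that] poly_eval_psubst)
  qed
  then have "f \<approx>\<^sub>J psubst E_var (psubst h f)"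
    by (simp add: jet_eq_iff_poly_eval_eq)
  moreover have "\<forall>v\<in>pvars (psubst h f). 2 \<le> jet_order v"
    using pvars_psubst[of h f] h(1) by blast
  ultimately show ?thesis
    unfolding polynomial_in_E_def by blast
qed

lemma invariant_low_order_imp_constant:
  assumes f: "strictly_gauge_invariant f" and fg: "f \<approx>\<^sub>J g" and g: "\<forall>v\<in>pvars g. jet_order v < 2"
  shows "constant_poly f"
proof -
  have "poly_eval J f = poly_eval (\<lambda>_. 0) g" if J: "jet_symmetric J" for J
  proof -
    \<comment> \<open>Invariance is first transferred to \<open>g\<close>, since the congruence of
      \<open>f\<close> and \<open>g\<close> is applied at the symmetric jet \<open>J\<close> and the
      passage to the residue takes place inside \<open>g\<close>.\<close>
    have "poly_eval J f = poly_eval (residue_jet J) g"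
      using jet_eq_imp_poly_eval_eq[OF fg J] poly_eval_residue_jet[OF strictly_gauge_invariant_cong[OF fg f] J]
      by simp
    also have "\<dots> = poly_eval (\<lambda>_. 0) g"
      by (rule poly_eval_cong) (use g residue_jet_order_less_2 in blast)
    finally show ?thesis .
  qed
  then show ?thesis
    unfolding constant_poly_def jet_eq_iff_poly_eval_eq by auto
qed

theorem mainTheorem2:
  fixes f :: "'n::finite jet rpoly"
  shows "(strictly_gauge_invariant f \<longleftrightarrow> polynomial_in_E f) \<and>
    (strictly_gauge_invariant f \<and> \<not> constant_poly f \<longrightarrow> involves_order_ge 2 f)"
  using polynomial_in_E_imp_invariant invariant_imp_polynomial_in_E invariant_low_order_imp_constant
  unfolding involves_order_ge_def by blast

end
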